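(* Let $\mathcal{A}$ be a finite alphabet and let $\mathbf{p},\mathbf{q}$ be irreducible pairs on $\mathcal{A}$ which are piece-wise order reversing and have the same Type. If $\mathcal{P}(\mathbf{p})=\mathcal{P}(\mathbf{q})$, then the non-labeled extended Rauzy classes of $\mathbf{p}$ and $\mathbf{q}$ coincide.
   Context: Let $n=\#\mathcal{A}\ge2$. A pair is $\mathbf{p}=(p_0,p_1)$ with $p_0,p_1:\mathcal{A}\to\{1,\dots,n\}$ bijections (row $\varepsilon$ lists $p_\varepsilon^{-1}(1),\dots,p_\varepsilon^{-1}(n)$). Irreducible: $p_0^{-1}\{1,\dots,k\}\ne p_1^{-1}\{1,\dots,k\}$ for $1\le k<n$. Rauzy move of type $\varepsilon$: $\varepsilon\mathbf{p}=(p'_0,p'_1)$, $p'_\varepsilon=p_\varepsilon$, and for $z=p_\varepsilon^{-1}(n)$, $p'_{1-\varepsilon}(b)=p_{1-\varepsilon}(b)$ if $p_{1-\varepsilon}(b)\le p_{1-\varepsilon}(z)$, $=p_{1-\varepsilon}(b)+1$ if $p_{1-\varepsilon}(z)<p_{1-\varepsilon}(b)<n$, $=p_{1-\varepsilon}(z)+1$ if $p_{1-\varepsilon}(b)=n$. Left Rauzy move of type $\varepsilon$: $\tilde\varepsilon\mathbf{p}=(p'_0,p'_1)$, $p'_\varepsilon=p_\varepsilon$, and for $a=p_\varepsilon^{-1}(1)$, $p'_{1-\varepsilon}(b)=p_{1-\varepsilon}(a)-1$ if $p_{1-\varepsilon}(b)=1$, $=p_{1-\varepsilon}(b)-1$ if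 $1<p_{1-\varepsilon}(b)<p_{1-\varepsilon}(a)$, $=p_{1-\varepsilon}(b)$ otherwise. The labeled extended Rauzy class of $\mathbf{p}$ is the set of pairs reachable from $\mathbf{p}$ by Rauzy and left Rauzy moves of both types; the non-labeled extended Rauzy class is its image under $(p_0,p_1)\mapsto p_1\circ p_0^{-1}\in\mathfrak{S}_n$. Define $\mathcal{S}(\mathbf{p}):\mathcal{A}\to\mathcal{A}$ by $\mathcal{S}(\mathbf{p})(\alpha)=p_0^{-1}(1)$ if $p_1(\alpha)=1$; $=p_0^{-1}(p_0(p_1^{-1}(n))+1)$ if $p_1(\alpha)=p_1(p_0^{-1}(n))+1$; $=p_0^{-1}(p_0(p_1^{-1}(p_1(\alpha)-1))+1)$ otherwise. $\mathcal{Y}(\mathbf{p})$ is the first return of $\mathcal{S}(\mathbf{p})$ to $\mathcal{A}\setminus\{p_0^{-1}(1)\}$, and $\mathcal{P}(\mathbf{p})$ is the unordered list with multiplicity of the cycle lengths of $\mathcal{Y}(\mathbf{p})$. Standard: $p_0^{-1}(1)=p_1^{-1}(n)$, $p_1^{-1}(1)=p_0^{-1}(n)$. A standard pair is piece-wise order reversing if there are $2=k_0<\dots<k_\ell=n$ with $B_i=p_0^{-1}\{k_{i-1},\dots,k_i-1\}=p_1^{-1}\{k_{i-1},\dots,k_i-1\}$ and $p_0(b)+p_1(b)=k_{i-1}+k_i-1$ for $b\in B_i$; the $B_i$ are blocks ($k$-block: $k$ letters). Chains: with the $1$-blocks $S_1,\dots,S_{k-1}$ listed left to right, chain $C_i$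 is the possibly empty sequence of consecutive blocks strictly between $S_{i-1}$ and $S_i$ ($C_1$ before $S_1$, $C_k$ after $S_{k-1}$). Types: $\langle1\rangle$: at most one nonempty chain, consisting (if present) of one block. Types $\langle2\rangle$–$\langle5\rangle$ require more than one block of size $\ge2$, and: $\langle2\rangle$: all nonempty chains consist of $2$-blocks; $\langle3\rangle$: each nonempty chain is (i) $m$ $2$-blocks, a $3$-block, $\ell$ $2$-blocks ($m,\ell\ge0$) or (ii) $m\ge1$ $2$-blocks, with at least one chain of form (i); $\langle4\rangle$: exactly one chain is a $4$-block followed by $m\ge0$ $2$-blocks, other nonempty chains consist of $2$-blocks; $\langle5\rangle$: exactly one chain is a single $5$-block, every other nonempty chain is exactly one $2$-block. *)

theory Defs
  imports Main "HOL-Library.Multiset" "HOL-Library.Cardinality"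
begin

text \<open>A pair on the finite alphabet 'a (of size n = CARD('a)) is (p0, p1).
  Letter positions are 1..n.  epsilon = 0 is encoded as False, epsilon = 1 as True.\<close>

type_synonym 'a ipair = "('a \<Rightarrow> nat) \<times> ('a \<Rightarrow> nat)"

definition is_pair :: "('a::finite) ipair \<Rightarrow> bool" where
  "is_pair p \<longleftrightarrow> bij_betw (fst p) UNIV {1 .. CARD('a)} \<and> bij_betw (snd p) UNIV {1 .. CARD('a)}"

definition irreducible_pair :: "('a::finite) ipair \<Rightarrow> bool" where
  "irreducible_pair p \<longleftrightarrow>
     (\<forall>k. 1 \<le> k \<and> k < CARD('a) \<longrightarrow> {a. fst p a \<in> {1 .. k}} \<noteq> {a. snd p a \<in> {1 .. k}})"

definition row :: "bool \<Rightarrow> 'a ipair \<Rightarrow> ('a \<Rightarrow> nat)" where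
  "row e p = (if e then snd p else fst p)"

definition mk_pair :: "bool \<Rightarrow> ('a \<Rightarrow> nat) \<Rightarrow> ('a \<Rightarrow> nat) \<Rightarrow> 'a ipair" where
  "mk_pair e x y = (if e then (y, x) else (x, y))"

definition rauzy :: "bool \<Rightarrow> ('a::finite) ipair \<Rightarrow> 'a ipair" where
  "rauzy e p = (let n = CARD('a); pe = row e p; po = row (\<not> e) p; z = inv pe n;
     po' = (\<lambda>b. if po b \<le> po z then po b
                else if po z < po b \<and> po b < n then po b + 1
                else if po b = n then po z + 1 else po b)
     in mk_pair e pe po')"

definition left_rauzy :: "bool \<Rightarrow> ('a::finite) ipair \<Rightarrow> 'a ipair" where
  "left_rauzy e p = (let pe = row e p; po = row (\<not> e) p; a = inv pe 1;
     po' = (\<lambda>b. if po b = 1 then po a - 1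
                else if 1 < po b \<and> po b < po a then po b - 1
                else po b)
     in mk_pair e pe po')"

definition ext_step :: "('a::finite) ipair \<Rightarrow> 'a ipair \<Rightarrow> bool" where
  "ext_step p q \<longleftrightarrow> (\<exists>e. q = rauzy e p \<or> q = left_rauzy e p)"

definition labeled_ext_class :: "('a::finite) ipair \<Rightarrow> 'a ipair set" where
  "labeled_ext_class p = {q. ext_step\<^sup>*\<^sup>* p q}"

definition perm_of_pair :: "('a::finite) ipair \<Rightarrow> nat \<Rightarrow> nat" where
  "perm_of_pair p = (\<lambda>k. if k \<in> {1 .. CARD('a)} then snd p (inv (fst p) k) else k)"

definition nonlabeled_ext_class :: "('a::finite) ipair \<Rightarrow> (nat \<Rightarrow> nat) set" where
  "nonlabeled_ext_class p = perm_of_pair ` labeled_ext_class p"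

definition S_map :: "('a::finite) ipair \<Rightarrow> 'a \<Rightarrow> 'a" where
  "S_map p \<alpha> = (let n = CARD('a); p0 = fst p; p1 = snd p in
     if p1 \<alpha> = 1 then inv p0 1
     else if p1 \<alpha> = p1 (inv p0 n) + 1 then inv p0 (p0 (inv p1 n) + 1)
     else inv p0 (p0 (inv p1 (p1 \<alpha> - 1)) + 1))"

definition Y_map :: "('a::finite) ipair \<Rightarrow> 'a \<Rightarrow> 'a" where
  "Y_map p \<alpha> = (let a0 = inv (fst p) 1 in
     (S_map p ^^ (LEAST k. 0 < k \<and> (S_map p ^^ k) \<alpha> \<noteq> a0)) \<alpha>)"

definition Y_cycles :: "('a::finite) ipair \<Rightarrow> 'a set set" where
  "Y_cycles p = (\<lambda>\<alpha>. {(Y_map p ^^ k) \<alpha> | k. True}) ` (UNIV - {inv (fst p) 1})"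

definition P_inv :: "('a::finite) ipair \<Rightarrow> nat multiset" where
  "P_inv p = image_mset card (mset_set (Y_cycles p))"

definition standard_pair :: "('a::finite) ipair \<Rightarrow> bool" where
  "standard_pair p \<longleftrightarrow> inv (fst p) 1 = inv (snd p) CARD('a) \<and> inv (snd p) 1 = inv (fst p) CARD('a)"

definition pwor_decomp :: "('a::finite) ipair \<Rightarrow> nat list \<Rightarrow> bool" where
  "pwor_decomp p ks \<longleftrightarrow> standard_pair p \<and> ks \<noteq> [] \<and> hd ks = 2 \<and> last ks = CARD('a) \<and>
     sorted_wrt (<) ks \<and>
     (\<forall>i. 0 < i \<and> i < length ks \<longrightarrow>
        (let a = ks ! (i - 1); b = ks ! i; B = {x. fst p x \<in> {a .. b - 1}} in
           B = {x. snd p x \<in> {a .. b - 1}} \<and> (\<forall>x\<in>B. fst p x + snd p x = a + b - 1)))"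

definition piecewise_order_reversing :: "('a::finite) ipair \<Rightarrow> bool" where
  "piecewise_order_reversing p \<longleftrightarrow> (\<exists>ks. pwor_decomp p ks)"

definition block_sizes :: "nat list \<Rightarrow> nat list" where
  "block_sizes ks = map (\<lambda>(a, b). b - a) (zip ks (tl ks))"

fun chains :: "nat list \<Rightarrow> nat list list" where
  "chains [] = [[]]"
| "chains (x # xs) = (let cs = chains xs in if x = 1 then [] # cs else (x # hd cs) # tl cs)"

definition many_big_blocks :: "nat list list \<Rightarrow> bool" where
  "many_big_blocks cs \<longleftrightarrow> length (filter (\<lambda>x. 2 \<le> x) (concat cs)) > 1"

definition type_cond :: "nat \<Rightarrow> nat list list \<Rightarrow> bool" where
  "type_cond t cs \<longleftrightarrow>
    (if t = 1 then length (filter (\<lambda>c. c \<noteq> []) cs) \<le> 1 \<and> (\<forall>c\<in>set cs. c \<noteq> [] \<longrightarrow> length c = 1)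
     else if t = 2 then many_big_blocks cs \<and> (\<forall>c\<in>set cs. \<forall>x\<in>set c. x = 2)
     else if t = 3 then many_big_blocks cs \<and>
        (\<forall>c\<in>set cs. c \<noteq> [] \<longrightarrow>
           (\<exists>m l. c = replicate m 2 @ [3] @ replicate l 2) \<or> (\<exists>m\<ge>1. c = replicate m 2)) \<and>
        (\<exists>c\<in>set cs. \<exists>m l. c = replicate m 2 @ [3] @ replicate l 2)
     else if t = 4 then many_big_blocks cs \<and>
        (\<exists>i<length cs. (\<exists>m. cs ! i = 4 # replicate m 2) \<and>
           (\<forall>j<length cs. j \<noteq> i \<longrightarrow> (\<forall>x\<in>set (cs ! j). x = 2)))
     else if t = 5 then many_big_blocks cs \<and>
        (\<exists>i<length cs. cs ! i = [5] \<and>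
           (\<forall>j<length cs. j \<noteq> i \<longrightarrow> cs ! j = [] \<or> cs ! j = [2]))
     else False)"

definition has_type :: "nat \<Rightarrow> ('a::finite) ipair \<Rightarrow> bool" where
  "has_type t p \<longleftrightarrow> (\<exists>ks. pwor_decomp p ks \<and> type_cond t (chains (block_sizes ks)))"

end

theory Submission
  imports Defs
begin

text \<open>Write a pair as its two rows. Powers of (left) Rauzy moves rotate the part of one row beyond the
  winner of the other; they are reversible and commute with relabelling, so two pairs whose rows are
  connected by rotations and relabellings have the same non-labeled class. A piece-wise order reversing
  pair is determined, up to relabelling, by its sequence of block sizes. Words that are never cut may stay
  uninterpreted during a chain of rotations. Four rotations interchange two chains, whatever their content.
  Peeling the last blocks off one at a time, in reverse order, reverses a chain, and done at the middle
  letter of a \<open>3\<close>-block it lets the numbers of \<open>2\<close>-blocks on the sides of two \<open>3\<close>-blocks be exchanged.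
  An explicit chain of rotations moves a \<open>4\<close>-block to another chain. Finally the cycles of
  \<^const>\<open>Y_map\<close> are computed chain by chain, and they determine the chains up to these operations.\<close>

section \<open>Words, rotations and relabellings\<close>

text \<open>Which rotations are needed is dictated by what the cycle lengths cannot see. A chain of
  \<open>m\<close> \<open>2\<close>-blocks contributes one cycle of odd length 2m+1; a
  \<open>3\<close>-block with \<open>m\<close> and \<open>l\<close> \<open>2\<close>-blocks beside
  it contributes two cycles of even lengths 2m+2 and 2l+2. Parity separates the two kinds of chains,
  but the order of the chains and the pairing of the even lengths are lost, so all permutations and
  all re-pairings have to be realised by rotations. A \<open>4\<close>-block followed by
  \<open>m\<close> \<open>2\<close>-blocks contributes 2m+5, exactly as m+2 \<open>2\<close>-blocks
  do, which forces the trade of a \<open>4\<close>-block against two \<open>2\<close>-blocks. The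
  obstacle is that most words met on the way are not standard, so the argument cannot stay with
  block sizes: the equivalence is proved for words, and only its end points are read as lists of
  sizes. The letters at the end points are then in no particular order, and it is relabelling that
  absorbs this.\<close>

text \<open>All powers of a (left) Rauzy move at once, which makes the relation visibly symmetric.\<close>

inductive rot :: "'a list \<times> 'a list \<Rightarrow> 'a list \<times> 'a list \<Rightarrow> bool" where
  TR: "rot (u @ [z], x @ z # y @ y') (u @ [z], x @ z # y' @ y)"
| BR: "rot (x @ z # y @ y', v @ [z]) (x @ z # y' @ y, v @ [z])"
| TL: "rot (a # u, y @ y' @ a # x) (a # u, y' @ y @ a # x)"
| BL: "rot (y @ y' @ a # x, a # v) (y' @ y @ a # x, a # v)"

inductive relabel :: "'a list \<times> 'a list \<Rightarrow> 'a list \<times> 'a list \<Rightarrow> bool" where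
  "bij f \<Longrightarrow> relabel (u, v) (map f u, map f v)"

definition equivalent :: "'a list \<times> 'a list \<Rightarrow> 'a list \<times> 'a list \<Rightarrow> bool"  (infix "\<approx>" 50) where
  "equivalent = (\<lambda>w w'. rot w w' \<or> relabel w w')\<^sup>*\<^sup>*"

lemma equiv_refl [simp]: "w \<approx> w"
  by (simp add: equivalent_def)

lemma equiv_trans [trans]: "w \<approx> w' \<Longrightarrow> w' \<approx> w'' \<Longrightarrow> w \<approx> w''"
  by (simp add: equivalent_def)

lemma rot_sym: "rot w w' \<Longrightarrow> rot w' w"
  by (induction rule: rot.induct) (rule rot.intros)+

lemma relabel_sym: "relabel w w' \<Longrightarrow> relabel w' w"
proof (induction rule: relabel.induct)
  case (1 f u v)
  then show ?case
    using relabel.intros[of "inv f" "map f u" "map f v"]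
    by (simp add: bij_imp_bij_inv bij_is_inj)
qed

lemma equiv_sym: "w \<approx> w' \<Longrightarrow> w' \<approx> w"
  unfolding equivalent_def
  by (rule sympD[OF symp_rtranclp]) (auto intro!: sympI dest: rot_sym relabel_sym)

lemma rot_imp_equiv: "rot w w' \<Longrightarrow> w \<approx> w'"
  by (simp add: equivalent_def r_into_rtranclp)

lemmas equiv_TR = rot_imp_equiv[OF TR]
  and equiv_BR = rot_imp_equiv[OF BR]
  and equiv_TL = rot_imp_equiv[OF TL]
  and equiv_BL = rot_imp_equiv[OF BL]

lemma equiv_relabel: "bij f \<Longrightarrow> (u, v) \<approx> (map f u, map f v)"
  by (simp add: equivalent_def r_into_rtranclp relabel.intros)

lemma rot_swap_rows: "rot w w' \<Longrightarrow> rot (prod.swap w) (prod.swap w')"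
  by (induction rule: rot.induct) (auto intro: rot.intros)

text \<open>Needed for the exchange of two \<open>3\<close>-blocks: there the second peeling takes
  place in words whose rows have been exchanged.\<close>

lemma equiv_swap_rows: "(u, v) \<approx> (u', v') \<Longrightarrow> (v, u) \<approx> (v', u')"
proof -
  have "w \<approx> w' \<Longrightarrow> prod.swap w \<approx> prod.swap w'" for w w' :: "'a list \<times> 'a list"
    unfolding equivalent_def
  proof (induction rule: rtranclp_induct)
    case (step y z)
    have "rot (prod.swap y) (prod.swap z) \<or> relabel (prod.swap y) (prod.swap z)"
      using step.hyps(2) by (auto dest: rot_swap_rows elim!: relabel.cases intro: relabel.intros)
    with step.IH show ?case
      by (rule rtranclp.rtrancl_into_rtrancl)
  qed simp
  from this[of "(u, v)" "(u', v')"] show "(u, v) \<approx> (u', v') \<Longrightarrow> (v, u) \<approx> (v', u')"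
    by simp
qed

section \<open>Words as rows of pairs\<close>

definition valid_word :: "('a::finite) list \<Rightarrow> bool" where
  "valid_word u \<longleftrightarrow> distinct u \<and> set u = UNIV"

fun valid :: "('a::finite) list \<times> 'a list \<Rightarrow> bool" where
  "valid (u, v) \<longleftrightarrow> valid_word u \<and> valid_word v"

lemma length_valid_word: "valid_word (u :: 'a::finite list) \<Longrightarrow> length u = CARD('a)"
  by (metis distinct_card valid_word_def)

lemma valid_rot: "rot w w' \<Longrightarrow> valid w \<Longrightarrow> valid w'"
  by (induction rule: rot.induct) (auto simp: valid_word_def)

lemma valid_word_map: "bij f \<Longrightarrow> valid_word u \<Longrightarrow> valid_word (map f u)"
  by (auto simp: valid_word_def distinct_map bij_is_inj bij_is_surj inj_on_subset)

lemma valid_relabel: "relabel w w' \<Longrightarrow> valid w \<Longrightarrow> valid w'"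
  by (induction rule: relabel.induct) (auto intro: valid_word_map)

lemma valid_equiv: "w \<approx> w' \<Longrightarrow> valid w \<Longrightarrow> valid w'"
  unfolding equivalent_def
  by (induction rule: rtranclp_induct) (auto dest: valid_rot valid_relabel)

definition irreducible_words :: "'a list \<times> 'a list \<Rightarrow> bool" where
  "irreducible_words w \<longleftrightarrow>
     (\<forall>k. 1 \<le> k \<and> k < length (fst w) \<longrightarrow> set (take k (fst w)) \<noteq> set (take k (snd w)))"

text \<open>Positions count from 1, as in \<open>is_pair\<close>. A letter missing from
  \<open>u\<close> gets \<open>length u + 1\<close>, so that \<open>pos_append\<close> needs no
  hypothesis on \<open>v\<close>.\<close>

definition pos :: "'a list \<Rightarrow> 'a \<Rightarrow> nat" where
  "pos u x = Suc (length (takeWhile (\<lambda>y. y \<noteq> x) u))"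

definition pair_of :: "'a list \<times> 'a list \<Rightarrow> 'a ipair" where
  "pair_of w = (pos (fst w), pos (snd w))"

lemma pos_Cons: "pos (y # u) x = (if y = x then 1 else Suc (pos u x))"
  by (simp add: pos_def)

lemma pos_append: "pos (u @ v) x = (if x \<in> set u then pos u x else length u + pos v x)"
  by (induction u) (auto simp: pos_Cons)

lemma pos_le: "x \<in> set u \<Longrightarrow> pos u x \<le> length u"
  by (induction u) (auto simp: pos_Cons)

lemma pos_gt_0 [simp]: "0 < pos u x" "pos u x \<noteq> 0"
  by (simp_all add: pos_def)

lemma nth_pos: "x \<in> set u \<Longrightarrow> u ! (pos u x - 1) = x"
proof (induction u)
  case (Cons y u)
  then show ?case
    by (cases "pos u x") (auto simp: pos_Cons pos_def)
qed simp

lemma pos_nth: "distinct u \<Longrightarrow> i < length u \<Longrightarrow> pos u (u ! i) = Suc i"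
  by (induction u arbitrary: i) (auto simp: pos_Cons nth_Cons split: nat.splits)

lemma inv_pos: "valid_word u \<Longrightarrow> i < length u \<Longrightarrow> inv (pos u) (Suc i) = u ! i"
  by (rule inv_f_eq) (auto simp: pos_nth valid_word_def inj_def, metis UNIV_I nth_pos)

lemma pos_map: "inj f \<Longrightarrow> pos (map f u) (f x) = pos u x"
  by (induction u) (auto simp: pos_def inj_eq)

text \<open>One Rauzy or left Rauzy move, for a winner that is not also the last (for left moves:
  the first) letter of the other row. The remaining cases are dealt with in
  \<open>ext_step_imp_move\<close>.\<close>

inductive move :: "'a list \<times> 'a list \<Rightarrow> 'a list \<times> 'a list \<Rightarrow> bool" where
  move_TR: "move (u @ [z], x @ z # y @ [w]) (u @ [z], x @ z # w # y)"
| move_BR: "move (x @ z # y @ [w], v @ [z]) (x @ z # w # y, v @ [z])"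
| move_TL: "move (a # u, w # y @ a # x) (a # u, y @ w # a # x)"
| move_BL: "move (w # y @ a # x, a # v) (y @ w # a # x, a # v)"

lemma move_imp_rot: "move w w' \<Longrightarrow> rot w w'"
proof (induction rule: move.induct)
  case (move_TR u z x y w) show ?case using TR[of u z x y "[w]"] by simp
next
  case (move_BR x z y w v) show ?case using BR[of x z y "[w]" v] by simp
next
  case (move_TL a u w y x) show ?case using TL[of a u "[w]" y x] by simp
next
  case (move_BL w y a x v) show ?case using BL[of "[w]" y a x v] by simp
qed

text \<open>One move takes the last letter of \<open>y'\<close> to the front of \<open>y\<close>;
  hence the induction on \<open>y'\<close> from its right end, with \<open>y\<close>
  arbitrary.\<close>

lemma moves_rotate_right:
  "move\<^sup>*\<^sup>* (u @ [z], x @ z # y @ y') (u @ [z], x @ z # y' @ y)"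
  "move\<^sup>*\<^sup>* (x @ z # y @ y', u @ [z]) (x @ z # y' @ y, u @ [z])"
proof -
  have "move\<^sup>*\<^sup>* (u @ [z], x @ z # y @ y') (u @ [z], x @ z # y' @ y) \<and>
        move\<^sup>*\<^sup>* (x @ z # y @ y', u @ [z]) (x @ z # y' @ y, u @ [z])"
  proof (induction y' arbitrary: y rule: rev_induct)
    case (snoc w y')
    have "move (u @ [z], x @ z # y @ y' @ [w]) (u @ [z], x @ z # w # y @ y')"
      "move (x @ z # y @ y' @ [w], u @ [z]) (x @ z # w # y @ y', u @ [z])"
      using move_TR[of u z x "y @ y'" w] move_BR[of x z "y @ y'" w u] by simp_all
    with snoc.IH[of "w # y"] show ?case
      by (auto intro: converse_rtranclp_into_rtranclp)
  qed simp
  then show "move\<^sup>*\<^sup>* (u @ [z], x @ z # y @ y') (u @ [z], x @ z # y' @ y)"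
    "move\<^sup>*\<^sup>* (x @ z # y @ y', u @ [z]) (x @ z # y' @ y, u @ [z])"
    by blast+
qed

lemma moves_rotate_left:
  "move\<^sup>*\<^sup>* (a # u, y @ y' @ a # x) (a # u, y' @ y @ a # x)"
  "move\<^sup>*\<^sup>* (y @ y' @ a # x, a # u) (y' @ y @ a # x, a # u)"
proof -
  have "move\<^sup>*\<^sup>* (a # u, y @ y' @ a # x) (a # u, y' @ y @ a # x) \<and>
        move\<^sup>*\<^sup>* (y @ y' @ a # x, a # u) (y' @ y @ a # x, a # u)"
  proof (induction y arbitrary: y')
    case (Cons w y)
    have "move (a # u, w # y @ y' @ a # x) (a # u, y @ y' @ w # a # x)"
      "move (w # y @ y' @ a # x, a # u) (y @ y' @ w # a # x, a # u)"
      using move_TL[of a u w "y @ y'" x] move_BL[of w "y @ y'" a x u] by simp_all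
    with Cons.IH[of "y' @ [w]"] show ?case
      by (auto intro: converse_rtranclp_into_rtranclp)
  qed simp
  then show "move\<^sup>*\<^sup>* (a # u, y @ y' @ a # x) (a # u, y' @ y @ a # x)"
    "move\<^sup>*\<^sup>* (y @ y' @ a # x, a # u) (y' @ y @ a # x, a # u)"
    by blast+
qed

text \<open>With \<open>rot_sym\<close> this makes reachability by single moves symmetric: a move is
  undone by repeating it until the rotated part has gone round once.\<close>

lemma rot_imp_moves: "rot w w' \<Longrightarrow> move\<^sup>*\<^sup>* w w'"
  by (induction rule: rot.induct) (auto intro: moves_rotate_right moves_rotate_left)

section \<open>Irreducibility is preserved\<close>

lemma irreducible_words_swap:
  "length u = length v \<Longrightarrow> irreducible_words (u, v) = irreducible_words (v, u)"
  by (auto simp: irreducible_words_def)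

text \<open>A proper prefix of the first row omits its last letter \<open>z\<close>. If the prefixes
  of length \<open>k\<close> have the same letters, the one of the second row therefore stays inside
  \<open>x\<close>, where nothing has changed.\<close>

lemma irreducible_rotate_right:
  assumes "irreducible_words (u @ [z], x @ z # y @ y')" "distinct (u @ [z])"
  shows "irreducible_words (u @ [z], x @ z # y' @ y)"
  unfolding irreducible_words_def
proof (intro allI impI notI)
  fix k assume k: "1 \<le> k \<and> k < length (fst (u @ [z], x @ z # y' @ y))"
    and eq: "set (take k (fst (u @ [z], x @ z # y' @ y))) = set (take k (snd (u @ [z], x @ z # y' @ y)))"
  have "z \<notin> set (take k (x @ z # y' @ y))"
    using k eq assms(2) by (auto dest: in_set_takeD)
  then have "k \<le> length x"
    by (auto simp: take_Cons' split: if_splits)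
  then have "set (take k (u @ [z])) = set (take k (x @ z # y @ y'))"
    using eq by simp
  then show False
    using assms(1) k by (auto simp: irreducible_words_def)
qed

text \<open>Dual argument: a nonempty prefix of the first row contains \<open>a\<close>, so a
  matching prefix of the second row contains all of \<open>y\<close> and \<open>y'\<close>, whose
  order does not affect its set of letters.\<close>

lemma irreducible_rotate_left:
  assumes "irreducible_words (a # u, y @ y' @ a # x)" "distinct (y @ y' @ a # x)"
  shows "irreducible_words (a # u, y' @ y @ a # x)"
  unfolding irreducible_words_def
proof (intro allI impI notI)
  fix k assume k: "1 \<le> k \<and> k < length (fst (a # u, y' @ y @ a # x))"
    and eq: "set (take k (fst (a # u, y' @ y @ a # x))) = set (take k (snd (a # u, y' @ y @ a # x)))"
  have "a \<in> set (take k (y' @ y @ a # x))"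
    using k eq by (auto simp: take_Cons' split: if_splits)
  then have "length (y' @ y) < k"
    using assms(2) by (cases "k \<le> length (y' @ y)") (auto dest: in_set_takeD)
  then have "set (take k (y' @ y @ a # x)) = set (take k (y @ y' @ a # x))"
    by (simp add: Un_left_commute add.commute)
  then show False
    using assms(1) k eq by (auto simp: irreducible_words_def)
qed

definition good :: "('a::finite) list \<times> 'a list \<Rightarrow> bool" where
  "good w \<longleftrightarrow> valid w \<and> irreducible_words w"

lemma good_rot: "rot w w' \<Longrightarrow> good w \<Longrightarrow> good w'"
proof -
  have len: "valid (u, v) \<Longrightarrow> length u = length v" for u v :: "'a list"
    by (simp add: length_valid_word)
  assume "rot w w'" "good w"
  moreover have "valid w'"
    using calculation by (auto simp: good_def intro: valid_rot)
  ultimately show "good w'"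
  proof (induction rule: rot.induct)
    case (TR u z x y y')
    then show ?case
      using irreducible_rotate_right[of u z x y y'] len[of "u @ [z]" "x @ z # y @ y'"]
      by (auto simp: good_def valid_word_def)
  next
    case (BR x z y y' v)
    then show ?case
      using irreducible_rotate_right[of v z x y y'] len[of "x @ z # y @ y'" "v @ [z]"]
      by (auto simp: good_def valid_word_def irreducible_words_swap[of _ "v @ [z]"])
  next
    case (TL a u y y' x)
    then show ?case
      using irreducible_rotate_left[of a u y y' x] len[of "a # u" "y @ y' @ a # x"]
      by (auto simp: good_def valid_word_def)
  next
    case (BL y y' a x v)
    then show ?case
      using irreducible_rotate_left[of a v y y' x] len[of "y @ y' @ a # x" "a # v"]
      by (auto simp: good_def valid_word_def irreducible_words_swap[of _ "a # v"])
  qed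
qed

lemma good_relabel: "relabel w w' \<Longrightarrow> good w \<Longrightarrow> good w'"
proof (induction rule: relabel.induct)
  case (1 f u v)
  then show ?case
    by (auto simp: good_def irreducible_words_def take_map inj_image_eq_iff[OF bij_is_inj]
        intro: valid_word_map)
qed

section \<open>Rotations with uninterpreted subwords\<close>

text \<open>Lower case variables are letters. A word \<open>X\<close> of the first row and its counterpart \<open>X'\<close> in the second row
  are unrelated and never cut, so they can stand for arbitrary sequences of blocks. The two long chains of
  rotations were found by a computer search.\<close>

lemma equiv_swap_chains:
  "(A # X @ k # Y @ m # W @ [z], z # X' @ k # Y' @ m # W' @ [A])
    \<approx> (k # Y @ A # X @ m # W @ [z], z # Y' @ A # X' @ m # W' @ [k])"
proof -
  have "(A # X @ k # Y @ m # W @ [z], z # X' @ k # Y' @ m # W' @ [A])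
      \<approx> (A # X @ k # Y @ m # W @ [z], m # W' @ z # X' @ k # Y' @ [A])"
    using equiv_TL[of A "X @ k # Y @ m # W @ [z]" "z # X' @ k # Y'" "m # W'" "[]"] by simp
  also have "\<dots> \<approx> (k # Y @ A # X @ m # W @ [z], m # W' @ z # X' @ k # Y' @ [A])"
    using equiv_BL[of "A # X" "k # Y" m "W @ [z]" "W' @ z # X' @ k # Y' @ [A]"] by simp
  also have "\<dots> \<approx> (k # Y @ A # X @ m # W @ [z], z # X' @ m # W' @ k # Y' @ [A])"
    using equiv_TL[of k "Y @ A # X @ m # W @ [z]" "m # W'" "z # X'" "Y' @ [A]"] by simp
  also have "\<dots> \<approx> (k # Y @ A # X @ m # W @ [z], z # Y' @ A # X' @ m # W' @ [k])"
    using equiv_TR[of "k # Y @ A # X @ m # W" z "[]" "X' @ m # W' @ [k]" "Y' @ [A]"] by simp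
  finally show ?thesis .
qed

text \<open>As \<open>z\<close> is last above and first below, it can rotate everything else in
  either row, and one rotation in each row is enough. Afterwards \<open>k\<close> is the first
  letter and \<open>A\<close> is a \<open>1\<close>-block.\<close>

lemma equiv_rotate_chains:
  "(A # X @ k # Y @ [z], z # X' @ k # Y' @ [A])
    \<approx> (k # Y @ A # X @ [z], z # Y' @ A # X' @ [k])"
proof -
  have "(A # X @ k # Y @ [z], z # X' @ k # Y' @ [A])
      \<approx> (k # Y @ A # X @ [z], z # X' @ k # Y' @ [A])"
    using equiv_BL[of "A # X" "k # Y" z "[]" "X' @ k # Y' @ [A]"] by simp
  also have "\<dots> \<approx> (k # Y @ A # X @ [z], z # Y' @ A # X' @ [k])"
    using equiv_TR[of "k # Y @ A # X" z "[]" "X' @ [k]" "Y' @ [A]"] by simp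
  finally show ?thesis .
qed

text \<open>The second row is the same at both ends; only its cut into blocks changes. On the left
  \<open>a b c d\<close> is a \<open>4\<close>-block and \<open>e f\<close>, \<open>g h\<close> are
  \<open>2\<close>-blocks, on the right \<open>c d\<close>, \<open>a b\<close> are
  \<open>2\<close>-blocks and \<open>g h e f\<close> is a \<open>4\<close>-block.\<close>

lemma equiv_four_block:
  "(A # a # b # c # d # X @ k # e # f # g # h # Y @ [z], z # d # c # b # a # X' @ k # f # e # h # g # Y' @ [A])
    \<approx> (A # c # d # a # b # X @ k # g # h # e # f # Y @ [z], z # d # c # b # a # X' @ k # f # e # h # g # Y' @ [A])"
proof -
  have "(A # a # b # c # d # X @ k # e # f # g # h # Y @ [z], z # d # c # b # a # X' @ k # f # e # h # g # Y' @ [A])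
      \<approx> (A # a # b # c # d # X @ k # e # f # g # h # Y @ [z], z # a # X' @ k # f # e # h # g # Y' @ A # d # c # [b])"
    using equiv_TR[of "A # a # b # c # d # X @ k # e # f # g # h # Y" z "[]" "d # c # [b]" "a # X' @ k # f # e # h # g # Y' @ [A]"] by simp
  also have "\<dots> \<approx> (g # h # Y @ A # a # b # c # d # X @ k # e # f # [z], z # a # X' @ k # f # e # h # g # Y' @ A # d # c # [b])"
    using equiv_BL[of "A # a # b # c # d # X @ k # e # [f]" "g # h # Y" z "[]" "a # X' @ k # f # e # h # g # Y' @ A # d # c # [b]"] by simp
  also have "\<dots> \<approx> (g # h # Y @ A # a # b # c # d # X @ k # e # f # [z], e # h # z # a # X' @ k # f # g # Y' @ A # d # c # [b])"
    using equiv_TL[of g "h # Y @ A # a # b # c # d # X @ k # e # f # [z]" "z # a # X' @ k # [f]" "e # [h]" "Y' @ A # d # c # [b]"] by simp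
  also have "\<dots> \<approx> (a # b # c # d # X @ k # g # h # Y @ A # e # f # [z], e # h # z # a # X' @ k # f # g # Y' @ A # d # c # [b])"
    using equiv_BL[of "g # h # Y @ [A]" "a # b # c # d # X @ [k]" e "f # [z]" "h # z # a # X' @ k # f # g # Y' @ A # d # c # [b]"] by simp
  also have "\<dots> \<approx> (a # b # Y @ A # e # f # z # c # d # X @ k # g # [h], e # h # z # a # X' @ k # f # g # Y' @ A # d # c # [b])"
    using equiv_BR[of "[a]" b "c # d # X @ k # g # [h]" "Y @ A # e # f # [z]" "e # h # z # a # X' @ k # f # g # Y' @ A # d # [c]"] by simp
  also have "\<dots> \<approx> (a # b # Y @ A # e # f # z # c # d # X @ k # g # [h], e # h # g # Y' @ A # d # c # b # z # a # X' @ k # [f])"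
    using equiv_TR[of "a # b # Y @ A # e # f # z # c # d # X @ k # [g]" h "[e]" "z # a # X' @ k # [f]" "g # Y' @ A # d # c # [b]"] by simp
  also have "\<dots> \<approx> (a # b # Y @ A # e # f # z # c # d # X @ k # g # [h], c # b # z # e # h # g # Y' @ A # d # a # X' @ k # [f])"
    using equiv_TL[of a "b # Y @ A # e # f # z # c # d # X @ k # g # [h]" "e # h # g # Y' @ A # [d]" "c # b # [z]" "X' @ k # [f]"] by simp
  also have "\<dots> \<approx> (e # f # z # a # b # Y @ A # c # d # X @ k # g # [h], c # b # z # e # h # g # Y' @ A # d # a # X' @ k # [f])"
    using equiv_BL[of "a # b # Y @ [A]" "e # f # [z]" c "d # X @ k # g # [h]" "b # z # e # h # g # Y' @ A # d # a # X' @ k # [f]"] by simp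
  also have "\<dots> \<approx> (e # f # Y @ A # c # d # X @ k # g # h # z # a # [b], c # b # z # e # h # g # Y' @ A # d # a # X' @ k # [f])"
    using equiv_BR[of "[e]" f "z # a # [b]" "Y @ A # c # d # X @ k # g # [h]" "c # b # z # e # h # g # Y' @ A # d # a # X' @ [k]"] by simp
  also have "\<dots> \<approx> (e # f # Y @ A # c # d # X @ k # g # h # z # a # [b], z # c # b # e # h # g # Y' @ A # d # a # X' @ k # [f])"
    using equiv_TL[of e "f # Y @ A # c # d # X @ k # g # h # z # a # [b]" "c # [b]" "[z]" "h # g # Y' @ A # d # a # X' @ k # [f]"] by simp
  also have "\<dots> \<approx> (A # c # d # X @ k # g # h # e # f # Y @ z # a # [b], z # c # b # e # h # g # Y' @ A # d # a # X' @ k # [f])"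
    using equiv_BL[of "e # f # Y" "A # c # d # X @ k # g # [h]" z "a # [b]" "c # b # e # h # g # Y' @ A # d # a # X' @ k # [f]"] by simp
  also have "\<dots> \<approx> (A # c # d # X @ k # g # h # e # f # Y @ z # a # [b], z # c # b # a # X' @ k # f # e # h # g # Y' @ A # [d])"
    using equiv_TR[of "A # c # d # X @ k # g # h # e # f # Y @ z # [a]" b "z # [c]" "e # h # g # Y' @ A # [d]" "a # X' @ k # [f]"] by simp
  also have "\<dots> \<approx> (A # c # d # a # b # X @ k # g # h # e # f # Y @ [z], z # c # b # a # X' @ k # f # e # h # g # Y' @ A # [d])"
    using equiv_BR[of "A # [c]" d "X @ k # g # h # e # f # Y @ [z]" "a # [b]" "z # c # b # a # X' @ k # f # e # h # g # Y' @ [A]"] by simp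
  also have "\<dots> \<approx> (A # c # d # a # b # X @ k # g # h # e # f # Y @ [z], z # d # c # b # a # X' @ k # f # e # h # g # Y' @ [A])"
    using equiv_TR[of "A # c # d # a # b # X @ k # g # h # e # f # Y" z "[]" "c # b # a # X' @ k # f # e # h # g # Y' @ [A]" "[d]"] by simp
  finally show ?thesis .
qed

text \<open>Both ends are half-peeled words. On the left the letters of a \<open>3\<close>-block
  \<open>a b c\<close> are dispersed: \<open>c\<close> has moved behind \<open>S\<close> above, and
  \<open>a\<close> has moved behind \<open>S'\<close> below. On the right the same has happened,
  with the rows exchanged, to the block of \<open>s\<close>, \<open>A\<close>, \<open>u\<close>,
  while \<open>a t c\<close> is a \<open>3\<close>-block. In the meantime \<open>P\<close> and
  \<open>Q\<close> have changed places.\<close>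

lemma equiv_three_block:
  "(A # P @ s # t # u # R @ k # Q @ a # b # S @ x # c # w # [z], z # P' @ u # t # s # R' @ k # Q' @ c # b # S' @ w # x # a # [A])
    \<approx> (k # Q @ a # t # c # R @ z # P @ s # A # S @ x # w # u # [b], b # Q' @ c # t # a # R' @ z # P' @ u # A # S' @ w # s # x # [k])"
proof -
  have "(A # P @ s # t # u # R @ k # Q @ a # b # S @ x # c # w # [z], z # P' @ u # t # s # R' @ k # Q' @ c # b # S' @ w # x # a # [A])
      \<approx> (A # S @ x # c # w # z # P @ s # t # u # R @ k # Q @ a # [b], z # P' @ u # t # s # R' @ k # Q' @ c # b # S' @ w # x # a # [A])"
    using equiv_BR[of "[]" A "P @ s # t # u # R @ k # Q @ a # [b]" "S @ x # c # w # [z]" "z # P' @ u # t # s # R' @ k # Q' @ c # b # S' @ w # x # [a]"] by simp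
  also have "\<dots> \<approx> (A # S @ x # c # w # z # P @ s # t # u # R @ k # Q @ a # [b], z # P' @ u # t # s # R' @ k # Q' @ c # b # a # A # S' @ w # [x])"
    using equiv_TR[of "A # S @ x # c # w # z # P @ s # t # u # R @ k # Q @ [a]" b "z # P' @ u # t # s # R' @ k # Q' @ [c]" "S' @ w # [x]" "a # [A]"] by simp
  also have "\<dots> \<approx> (A # S @ x # w # z # P @ s # t # u # R @ k # Q @ a # b # [c], z # P' @ u # t # s # R' @ k # Q' @ c # b # a # A # S' @ w # [x])"
    using equiv_BR[of "A # S" x "[c]" "w # z # P @ s # t # u # R @ k # Q @ a # [b]" "z # P' @ u # t # s # R' @ k # Q' @ c # b # a # A # S' @ [w]"] by simp
  also have "\<dots> \<approx> (A # S @ x # w # z # P @ s # t # u # R @ k # Q @ a # b # [c], z # P' @ u # t # s # R' @ k # Q' @ c # x # b # a # A # S' @ [w])"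
    using equiv_TR[of "A # S @ x # w # z # P @ s # t # u # R @ k # Q @ a # [b]" c "z # P' @ u # t # s # R' @ k # Q'" "b # a # A # S' @ [w]" "[x]"] by simp
  also have "\<dots> \<approx> (A # S @ x # w # u # R @ k # Q @ a # b # c # z # P @ s # [t], z # P' @ u # t # s # R' @ k # Q' @ c # x # b # a # A # S' @ [w])"
    using equiv_BR[of "A # S @ [x]" w "z # P @ s # [t]" "u # R @ k # Q @ a # b # [c]" "z # P' @ u # t # s # R' @ k # Q' @ c # x # b # a # A # S'"] by simp
  also have "\<dots> \<approx> (A # S @ x # w # u # R @ k # Q @ a # b # c # z # P @ s # [t], z # P' @ u # t # a # A # S' @ w # s # R' @ k # Q' @ c # x # [b])"
    using equiv_TR[of "A # S @ x # w # u # R @ k # Q @ a # b # c # z # P @ [s]" t "z # P' @ [u]" "s # R' @ k # Q' @ c # x # [b]" "a # A # S' @ [w]"] by simp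
  also have "\<dots> \<approx> (k # Q @ a # b # c # A # S @ x # w # u # R @ z # P @ s # [t], z # P' @ u # t # a # A # S' @ w # s # R' @ k # Q' @ c # x # [b])"
    using equiv_BL[of "A # S @ x # w # u # R" "k # Q @ a # b # [c]" z "P @ s # [t]" "P' @ u # t # a # A # S' @ w # s # R' @ k # Q' @ c # x # [b]"] by simp
  also have "\<dots> \<approx> (k # Q @ a # b # R @ z # P @ s # t # c # A # S @ x # w # [u], z # P' @ u # t # a # A # S' @ w # s # R' @ k # Q' @ c # x # [b])"
    using equiv_BR[of "k # Q @ [a]" b "c # A # S @ x # w # [u]" "R @ z # P @ s # [t]" "z # P' @ u # t # a # A # S' @ w # s # R' @ k # Q' @ c # [x]"] by simp
  also have "\<dots> \<approx> (k # Q @ a # b # R @ z # P @ s # t # c # A # S @ x # w # [u], z # P' @ u # A # S' @ w # s # R' @ k # Q' @ c # x # b # t # [a])"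
    using equiv_TR[of "k # Q @ a # b # R @ z # P @ s # t # c # A # S @ x # [w]" u "z # P'" "t # [a]" "A # S' @ w # s # R' @ k # Q' @ c # x # [b]"] by simp
  also have "\<dots> \<approx> (k # Q @ a # t # c # A # S @ x # w # u # b # R @ z # P @ [s], z # P' @ u # A # S' @ w # s # R' @ k # Q' @ c # x # b # t # [a])"
    using equiv_BR[of "k # Q" a "b # R @ z # P @ [s]" "t # c # A # S @ x # w # [u]" "z # P' @ u # A # S' @ w # s # R' @ k # Q' @ c # x # b # [t]"] by simp
  also have "\<dots> \<approx> (k # Q @ a # t # c # A # S @ x # w # u # b # R @ z # P @ [s], z # P' @ u # A # S' @ w # s # x # b # t # a # R' @ k # Q' @ [c])"
    using equiv_TR[of "k # Q @ a # t # c # A # S @ x # w # u # b # R @ z # P" s "z # P' @ u # A # S' @ [w]" "R' @ k # Q' @ [c]" "x # b # t # [a]"] by simp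
  also have "\<dots> \<approx> (k # Q @ a # t # c # R @ z # P @ s # A # S @ x # w # u # [b], z # P' @ u # A # S' @ w # s # x # b # t # a # R' @ k # Q' @ [c])"
    using equiv_BR[of "k # Q @ a # [t]" c "A # S @ x # w # u # [b]" "R @ z # P @ [s]" "z # P' @ u # A # S' @ w # s # x # b # t # a # R' @ k # Q'"] by simp
  also have "\<dots> \<approx> (k # Q @ a # t # c # R @ z # P @ s # A # S @ x # w # u # [b], b # t # a # R' @ z # P' @ u # A # S' @ w # s # x # k # Q' @ [c])"
    using equiv_TL[of k "Q @ a # t # c # R @ z # P @ s # A # S @ x # w # u # [b]" "z # P' @ u # A # S' @ w # s # [x]" "b # t # a # R'" "Q' @ [c]"] by simp
  also have "\<dots> \<approx> (k # Q @ a # t # c # R @ z # P @ s # A # S @ x # w # u # [b], b # Q' @ c # t # a # R' @ z # P' @ u # A # S' @ w # s # x # [k])"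
    using equiv_TR[of "k # Q @ a # t # c # R @ z # P @ s # A # S @ x # w # [u]" b "[]" "t # a # R' @ z # P' @ u # A # S' @ w # s # x # [k]" "Q' @ [c]"] by simp
  finally show ?thesis .
qed


section \<open>Invariance of the non-labeled extended Rauzy class\<close>

text \<open>The left-hand side repeats \<open>po'\<close> from the definition of
  \<open>rauzy\<close>. Positions are compared separately for \<open>b\<close> in \<open>x\<close>,
  \<open>b = z\<close>, \<open>b\<close> in \<open>y\<close> and \<open>b = w\<close>.\<close>

lemma rotated_right_row:
  assumes "valid_word u" "valid_word (x @ z # y @ [w])" "last u = z" "u \<noteq> []"
  shows "(let n = CARD('a); po = pos (x @ z # y @ [w]); z = inv (pos u) n in
      (\<lambda>b. if po b \<le> po z then po b else if po z < po b \<and> po b < n then po b + 1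
           else if po b = n then po z + 1 else po b)) = pos (x @ z # w # (y :: 'a::finite list))"
proof -
  have n: "CARD('a) = length x + length y + 2"
    using length_valid_word[OF assms(2)] by simp
  have z: "inv (pos u) (CARD('a)) = z"
    using inv_pos[OF assms(1), of "CARD('a) - 1"] length_valid_word[OF assms(1)] assms(3,4)
    by (simp add: last_conv_nth)
  have d: "distinct (x @ z # y @ [w])" and s: "set (x @ z # y @ [w]) = UNIV"
    using assms(2) by (auto simp: valid_word_def)
  show ?thesis
  proof
    fix b
    have "b \<in> set x \<or> b = z \<or> b \<in> set y \<or> b = w"
      using s by auto
    then show "(let n = CARD('a); po = pos (x @ z # y @ [w]); z = inv (pos u) n in
      (\<lambda>b. if po b \<le> po z then po b else if po z < po b \<and> po b < n then po b + 1
           else if po b = n then po z + 1 else po b)) b = pos (x @ z # w # y) b"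
      using d pos_le[of b x] pos_le[of b y]
      unfolding Let_def z unfolding n
      by (elim disjE) (auto simp: pos_append pos_Cons)
  qed
qed

lemma unrotated_right_row:
  assumes "valid_word u" "valid_word (x @ [z])" "last u = z" "u \<noteq> []"
  shows "(let n = CARD('a); po = pos (x @ [z]); z = inv (pos u) n in
      (\<lambda>b. if po b \<le> po z then po b else if po z < po b \<and> po b < n then po b + 1
           else if po b = n then po z + 1 else po b)) = pos (x @ [z :: 'a::finite])"
proof -
  have z: "inv (pos u) (CARD('a)) = z"
    using inv_pos[OF assms(1), of "CARD('a) - 1"] length_valid_word[OF assms(1)] assms(3,4)
    by (simp add: last_conv_nth)
  have "z \<notin> set x"
    using assms(2) by (simp add: valid_word_def)
  then have "pos (x @ [z]) z = length (x @ [z])"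
    by (simp add: pos_append pos_Cons)
  moreover have "b \<in> set (x @ [z])" for b
    using assms(2) unfolding valid_word_def by blast
  ultimately have "pos (x @ [z]) b \<le> pos (x @ [z]) z" for b
    using pos_le by metis
  then show ?thesis
    unfolding Let_def z by simp
qed

lemma rotated_left_row:
  assumes "valid_word u" "valid_word (w # y @ a # x)" "hd u = a" "u \<noteq> []"
  shows "(let po = pos (w # y @ a # x); a = inv (pos u) 1 in
      (\<lambda>b. if po b = 1 then po a - 1 else if 1 < po b \<and> po b < po a then po b - 1 else po b))
    = pos (y @ w # a # (x :: 'a::finite list))"
proof -
  have a: "inv (pos u) (Suc 0) = a"
    using inv_pos[OF assms(1), of 0] length_valid_word[OF assms(1)] assms(3,4)
    by (simp add: hd_conv_nth)
  have d: "distinct (w # y @ a # x)" and s: "set (w # y @ a # x) = UNIV"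
    using assms(2) by (auto simp: valid_word_def)
  show ?thesis
  proof
    fix b
    have "b \<in> set x \<or> b = a \<or> b \<in> set y \<or> b = w"
      using s by auto
    then show "(let po = pos (w # y @ a # x); a = inv (pos u) 1 in
      (\<lambda>b. if po b = 1 then po a - 1 else if 1 < po b \<and> po b < po a then po b - 1 else po b)) b
      = pos (y @ w # a # x) b"
      using d pos_le[of b x] pos_le[of b y]
      by (elim disjE) (auto simp: Let_def a pos_append pos_Cons)
  qed
qed

text \<open>Irreducibility is what excludes the junk value \<open>po a - 1 = 0\<close> in \<^const>\<open>left_rauzy\<close>.\<close>

lemma irreducible_hd_neq:
  assumes "good (u, v :: 'a::finite list)" "CARD('a) \<ge> 2"
  shows "hd u \<noteq> hd v"
proof
  assume "hd u = hd v"
  moreover have len: "length u \<ge> 2" "length v \<ge> 2"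
    using assms by (auto simp: good_def length_valid_word)
  from len have "take 1 u = [hd u]" "take 1 v = [hd v]"
    by (cases u, simp_all) (cases v, simp_all)
  ultimately show False
    using assms len by (auto simp: good_def irreducible_words_def)
qed

text \<open>Splitting the other row at the winner exhibits the move. If the winner ends both rows,
  the Rauzy move is the identity, whence the alternative \<open>w' = w\<close>; for left moves the
  analogous case is excluded by \<open>irreducible_hd_neq\<close>.\<close>

lemma ext_step_imp_move:
  assumes g: "good w" and card: "CARD('a) \<ge> 2"
    and step: "ext_step (pair_of (w :: 'a::finite list \<times> 'a list)) q"
  shows "\<exists>w'. (w' = w \<or> move w w') \<and> q = pair_of w'"
proof -
  obtain u v where w: "w = (u, v)" by force
  have vu: "valid_word u" and vv: "valid_word v"
    using g by (auto simp: good_def w)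
  have g': "good (v, u)"
    using g vu vv by (auto simp: good_def w irreducible_words_swap[of u v] length_valid_word)
  have ne: "u \<noteq> []" "v \<noteq> []"
    using vu vv card length_valid_word[of u] length_valid_word[of v] by auto
  have right: "(\<exists>x z. b = x @ [z] \<and> last a = z) \<or> (\<exists>x z y c. b = x @ z # y @ [c] \<and> last a = z)"
    if b: "valid_word b" for a b :: "'a list"
  proof -
    have "last a \<in> set b"
      using b by (simp add: valid_word_def)
    then obtain x y where xy: "b = x @ last a # y"
      by (meson split_list)
    show ?thesis
      using xy by (cases y rule: rev_cases) auto
  qed
  have left: "\<exists>x c y. b = c # y @ hd a # x"
    if b: "valid_word b" and hd: "hd a \<noteq> hd b" for a b :: "'a list"
  proof -
    have "hd a \<in> set b"
      using b by (simp add: valid_word_def)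
    then obtain x y where "b = y @ hd a # x"
      by (meson split_list)
    with hd show ?thesis
      by (cases y) auto
  qed
  from step obtain e where e: "q = rauzy e (pair_of w) \<or> q = left_rauzy e (pair_of w)"
      by (auto simp: ext_step_def)
    show ?thesis
    proof (cases "q = rauzy e (pair_of w)")
      case r: True
      show ?thesis
      proof (cases e)
        case True
        consider x where "u = x @ [last v]" | x y c where "u = x @ last v # y @ [c]"
          using right[OF vu, of v] by auto
        then show ?thesis
        proof cases
          case 1
          then have "q = pair_of w"
            using unrotated_right_row[of v x "last v"] vu vv ne True r
            by (simp add: rauzy_def row_def mk_pair_def pair_of_def w Let_def)
          then show ?thesis by blast
        next
          case 2
          then have "q = pair_of (x @ last v # c # y, v)"
            using rotated_right_row[of v x "last v" y c] vu vv ne True r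
            by (simp add: rauzy_def row_def mk_pair_def pair_of_def w Let_def)
          moreover have "move w (x @ last v # c # y, v)"
            using 2 move_BR[of x "last v" y c "butlast v"] ne by (simp add: w)
          ultimately show ?thesis by blast
        qed
      next
        case False
        consider x where "v = x @ [last u]" | x y c where "v = x @ last u # y @ [c]"
          using right[OF vv, of u] by auto
        then show ?thesis
        proof cases
          case 1
          then have "q = pair_of w"
            using unrotated_right_row[of u x "last u"] vu vv ne False r
            by (simp add: rauzy_def row_def mk_pair_def pair_of_def w Let_def)
          then show ?thesis by blast
        next
          case 2
          then have "q = pair_of (u, x @ last u # c # y)"
            using rotated_right_row[of u x "last u" y c] vu vv ne False r
            by (simp add: rauzy_def row_def mk_pair_def pair_of_def w Let_def)
          moreover have "move w (u, x @ last u # c # y)"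
            using 2 move_TR[of "butlast u" "last u" x y c] ne by (simp add: w)
          ultimately show ?thesis by blast
        qed
      qed
    next
      case False
      with e have l: "q = left_rauzy e (pair_of w)" by simp
      show ?thesis
      proof (cases e)
        case True
        obtain x c y where u: "u = c # y @ hd v # x"
          using left[OF vu, of v] irreducible_hd_neq[OF g'] card by auto
        then have "q = pair_of (y @ c # hd v # x, v)"
          using rotated_left_row[of v c y "hd v" x] vu vv ne True l
          by (simp add: left_rauzy_def row_def mk_pair_def pair_of_def w Let_def)
        moreover have "move w (y @ c # hd v # x, v)"
          using u move_BL[of c y "hd v" x "tl v"] ne by (simp add: w)
        ultimately show ?thesis by blast
      next
        case False
        obtain x c y where v: "v = c # y @ hd u # x"
          using left[OF vv, of u] irreducible_hd_neq[of u v] g card by (auto simp: w)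
        then have "q = pair_of (u, y @ c # hd u # x)"
          using rotated_left_row[of u c y "hd u" x] vu vv ne False l
          by (simp add: left_rauzy_def row_def mk_pair_def pair_of_def w Let_def)
        moreover have "move w (u, y @ c # hd u # x)"
          using v move_TL[of "hd u" "tl u" c y x] ne by (simp add: w)
        ultimately show ?thesis by blast
      qed
    qed
  qed

lemma move_imp_ext_step:
  assumes "valid w" "move (w :: 'a::finite list \<times> 'a list) w'"
  shows "ext_step (pair_of w) (pair_of w')"
proof -
  obtain u v where w: "w = (u, v)" by force
  have vu: "valid_word u" and vv: "valid_word v"
    using assms(1) by (auto simp: w)
  have "move (u, v) w'"
    using assms(2) by (simp add: w)
  then have "\<exists>e. pair_of w' = rauzy e (pair_of w) \<or> pair_of w' = left_rauzy e (pair_of w)"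
  proof cases
    case (move_TR u' z x y c)
    then show ?thesis
      using rotated_right_row[of u x z y c] vu vv
      by (intro exI[of _ False])
        (simp add: rauzy_def row_def mk_pair_def pair_of_def w Let_def)
  next
    case (move_BR x z y c v')
    then show ?thesis
      using rotated_right_row[of v x z y c] vu vv
      by (intro exI[of _ True])
        (simp add: rauzy_def row_def mk_pair_def pair_of_def w Let_def)
  next
    case (move_TL a u' c y x)
    then show ?thesis
      using rotated_left_row[of u c y a x] vu vv
      by (intro exI[of _ False])
        (simp add: left_rauzy_def row_def mk_pair_def pair_of_def w Let_def)
  next
    case (move_BL c y a x v')
    then show ?thesis
      using rotated_left_row[of v c y a x] vu vv
      by (intro exI[of _ True])
        (simp add: left_rauzy_def row_def mk_pair_def pair_of_def w Let_def)
  qed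
  then show ?thesis
    by (auto simp: ext_step_def)
qed

lemma good_moves: "move\<^sup>*\<^sup>* w w' \<Longrightarrow> good w \<Longrightarrow> good w'"
  by (induction rule: rtranclp_induct) (auto intro: good_rot move_imp_rot)

lemma labeled_ext_class_pair_of:
  assumes "good (w :: 'a::finite list \<times> 'a list)" "CARD('a) \<ge> 2"
  shows "labeled_ext_class (pair_of w) = pair_of ` {w'. move\<^sup>*\<^sup>* w w'}"
proof (intro equalityI subsetI)
  fix q assume "q \<in> labeled_ext_class (pair_of w)"
  then have "ext_step\<^sup>*\<^sup>* (pair_of w) q"
    by (simp add: labeled_ext_class_def)
  then have "\<exists>w'. move\<^sup>*\<^sup>* w w' \<and> q = pair_of w'"
  proof (induction rule: rtranclp_induct)
    case (step q q')
    then obtain w' where w': "move\<^sup>*\<^sup>* w w'" "q = pair_of w'" by blast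
    with step.hyps(2) obtain w'' where "w'' = w' \<or> move w' w''" "q' = pair_of w''"
      using ext_step_imp_move[OF good_moves[OF w'(1) assms(1)] assms(2)] by blast
    with w'(1) show ?case
      by (metis rtranclp.rtrancl_into_rtrancl)
  qed blast
  then show "q \<in> pair_of ` {w'. move\<^sup>*\<^sup>* w w'}" by blast
next
  fix q assume "q \<in> pair_of ` {w'. move\<^sup>*\<^sup>* w w'}"
  then obtain w' where "move\<^sup>*\<^sup>* w w'" "q = pair_of w'" by blast
  moreover have "move\<^sup>*\<^sup>* w w' \<Longrightarrow> ext_step\<^sup>*\<^sup>* (pair_of w) (pair_of w')"
  proof (induction rule: rtranclp_induct)
    case (step y z)
    then show ?case
      using move_imp_ext_step[of y z] good_moves[OF step.hyps(1) assms(1)] unfolding good_def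
      by (meson rtranclp.rtrancl_into_rtrancl)
  qed simp
  ultimately show "q \<in> labeled_ext_class (pair_of w)"
    by (simp add: labeled_ext_class_def)
qed

lemma nonlabeled_ext_class_rot:
  assumes "rot w w'" "good (w :: 'a::finite list \<times> 'a list)" "CARD('a) \<ge> 2"
  shows "nonlabeled_ext_class (pair_of w) = nonlabeled_ext_class (pair_of w')"
proof -
  have "move\<^sup>*\<^sup>* w x \<longleftrightarrow> move\<^sup>*\<^sup>* w' x" for x
    using rot_imp_moves[OF assms(1)] rot_imp_moves[OF rot_sym[OF assms(1)]] by auto
  then show ?thesis
    using assms good_rot[OF assms(1,2)]
    by (simp add: nonlabeled_ext_class_def labeled_ext_class_pair_of)
qed

text \<open>Relabelling composes both rows with the same bijection of the alphabet, which cancels in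
  the permutation.\<close>

lemma perm_of_pair_relabel:
  assumes "relabel w w'" "valid (w :: 'a::finite list \<times> 'a list)"
  shows "perm_of_pair (pair_of w') = perm_of_pair (pair_of w)"
  using assms
proof (induction rule: relabel.induct)
  case (1 f u v)
  have inv: "inv (pos u') k = u' ! (k - 1)" if "k \<in> {1..CARD('a)}" "valid_word u'" for k and u' :: "'a list"
    using inv_pos[OF that(2), of "k - 1"] that length_valid_word[OF that(2)] by auto
  have "k - 1 < length u" if "k \<in> {1..CARD('a)}" for k
    using that 1 length_valid_word[of u] by auto
  with 1 show ?case
    by (auto simp: perm_of_pair_def pair_of_def inv valid_word_map pos_map bij_is_inj)
qed

lemma relabel_moves:
  assumes "move\<^sup>*\<^sup>* w x" "relabel w w'"
  shows "\<exists>x'. move\<^sup>*\<^sup>* w' x' \<and> relabel x x'"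
proof -
  obtain f u v where f: "bij f" and w: "w = (u, v)" "w' = (map f u, map f v)"
    using assms(2) by (auto elim: relabel.cases)
  have m: "move (map f (fst y), map f (snd y)) (map f (fst y'), map f (snd y'))"
    if "move y y'" for y y'
    using that by (induction rule: move.induct) (auto intro: move.intros)
  have "move\<^sup>*\<^sup>* (map f (fst w), map f (snd w)) (map f (fst x), map f (snd x))"
    using assms(1)
  proof (induction rule: rtranclp_induct)
    case (step y y')
    from step.IH m[OF step.hyps(2)] show ?case
      by (rule rtranclp.rtrancl_into_rtrancl)
  qed simp
  then show ?thesis
    using relabel.intros[OF f, of "fst x" "snd x"] by (auto simp: w)
qed

text \<open>The labeled classes of \<open>w\<close> and \<open>w'\<close> may differ, but moves
  commute with \<open>map f\<close>, so the words reached from \<open>w\<close> and from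
  \<open>w'\<close> correspond to each other and have equal permutations.\<close>

lemma nonlabeled_ext_class_relabel:
  assumes "relabel w w'" "good (w :: 'a::finite list \<times> 'a list)" "CARD('a) \<ge> 2"
  shows "nonlabeled_ext_class (pair_of w) = nonlabeled_ext_class (pair_of w')"
proof -
  have "nonlabeled_ext_class (pair_of w) \<subseteq> nonlabeled_ext_class (pair_of w')"
    if r: "relabel w w'" and g: "good w" for w w' :: "'a list \<times> 'a list"
  proof
    fix g assume "g \<in> nonlabeled_ext_class (pair_of w)"
    then obtain x where x: "move\<^sup>*\<^sup>* w x" "g = perm_of_pair (pair_of x)"
      using g assms(3) by (auto simp: nonlabeled_ext_class_def labeled_ext_class_pair_of)
    obtain x' where x': "move\<^sup>*\<^sup>* w' x'" "relabel x x'"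
      using relabel_moves[OF x(1) r] by blast
    moreover have "perm_of_pair (pair_of x') = g"
      using perm_of_pair_relabel[OF x'(2)] good_moves[OF x(1) g] x(2) by (simp add: good_def)
    ultimately show "g \<in> nonlabeled_ext_class (pair_of w')"
      using good_relabel[OF r g] assms(3)
      by (auto simp: nonlabeled_ext_class_def labeled_ext_class_pair_of)
  qed
  from this[OF assms(1,2)] this[OF relabel_sym[OF assms(1)] good_relabel[OF assms(1,2)]]
  show ?thesis by blast
qed

lemma nonlabeled_ext_class_equiv:
  assumes "w \<approx> w'" "good (w :: 'a::finite list \<times> 'a list)" "CARD('a) \<ge> 2"
  shows "nonlabeled_ext_class (pair_of w) = nonlabeled_ext_class (pair_of w')"
proof -
  have "good w' \<and> nonlabeled_ext_class (pair_of w) = nonlabeled_ext_class (pair_of w')"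
    using assms(1) unfolding equivalent_def
  proof (induction rule: rtranclp_induct)
    case base
    then show ?case using assms(2) by simp
  next
    case (step y z)
    then show ?case
      using nonlabeled_ext_class_rot[of y z] nonlabeled_ext_class_relabel[of y z]
        good_rot[of y z] good_relabel[of y z] assms(3) by metis
  qed
  then show ?thesis by blast
qed

section \<open>Standard words with prescribed block sizes\<close>

text \<open>Normal form of a piece-wise order reversing pair: first letter \<open>a\<close>, last
  letter \<open>z\<close>, and blocks \<open>bs\<close>, each of them reversed in the second
  row.\<close>

definition block_words :: "'a \<Rightarrow> 'a \<Rightarrow> 'a list list \<Rightarrow> 'a list \<times> 'a list" where
  "block_words a z bs = (a # concat bs @ [z], z # concat (map rev bs) @ [a])"

lemma valid_block_words:
  assumes "valid_word (a # concat bs @ [z])"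
  shows "valid (block_words a z bs)"
proof -
  have m: "mset (concat (map rev bs)) = mset (concat bs)"
    by (induction bs) auto
  have "mset (z # concat (map rev bs) @ [a]) = mset (a # concat bs @ [z])"
    by (simp add: m)
  then have "valid_word (z # concat (map rev bs) @ [a])"
    using assms unfolding valid_word_def
    by (metis mset_eq_imp_distinct_iff mset_eq_setD)
  with assms show ?thesis
    by (simp add: block_words_def)
qed

lemma sum_lengths_block_words:
  "valid (block_words a z bs :: 'a::finite list \<times> 'a list) \<Longrightarrow>
    sum_list (map length bs) + 2 = CARD('a::finite)"
  using length_valid_word[of "a # concat bs @ [z]"] by (simp add: block_words_def length_concat)

lemma ex_split_lengths: "sum_list ns = length xs \<Longrightarrow> \<exists>bs. concat bs = xs \<and> map length bs = ns"
proof (induction ns arbitrary: xs)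
  case (Cons n ns)
  have "sum_list ns = length (drop n xs)"
    using Cons.prems by simp
  from Cons.IH[OF this] obtain bs where "concat bs = drop n xs" "map length bs = ns"
    by blast
  with Cons.prems show ?case
    by (intro exI[of _ "take n xs # bs"]) auto
qed simp

lemma ex_block_words:
  assumes "sum_list ns + 2 = CARD('a::finite)"
  obtains a z :: "'a::finite" and bs where "valid (block_words a z bs)" "map length bs = ns"
proof -
  obtain u :: "'a list" where u: "distinct u" "set u = UNIV"
    using finite_distinct_list[of "UNIV :: 'a set"] by auto
  have len: "length u = sum_list ns + 2"
    using assms u distinct_card[of u] by simp
  then obtain a v where v: "u = a # v" by (cases u) auto
  with len obtain w z where "v = w @ [z]" by (cases v rule: rev_cases) auto
  with v len obtain bs where "u = a # concat bs @ [z]" "map length bs = ns"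
    using ex_split_lengths[of ns w] by auto
  with u that[of a z bs] valid_block_words[of a bs z] show thesis
    by (simp add: valid_word_def)
qed

text \<open>The bijection that matches the first rows letter by letter respects the cut into blocks,
  because the lengths agree; hence it also matches the second rows.\<close>

lemma block_words_equiv:
  assumes v: "valid (block_words a z bs)" "valid (block_words a' z' bs')"
    and len: "map length bs = map length bs'"
  shows "block_words a z bs \<approx> block_words a' z' bs'"
proof -
  define u u' where "u = a # concat bs @ [z]" and "u' = a' # concat bs' @ [z']"
  have u: "valid_word u" "valid_word u'"
    using v by (auto simp: u_def u'_def block_words_def)
  have "length u = length u'"
    by (simp add: u_def u'_def length_concat len)
  define f where "f x = u' ! (pos u x - 1)" for x
  have fu: "map f u = u'"
    using u \<open>length u = length u'\<close>
    by (intro nth_equalityI) (auto simp: f_def pos_nth valid_word_def)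
  have "inj f"
    using u fu by (metis distinct_map valid_word_def)
  then have "bij f"
    by (simp add: bij_def finite_UNIV_inj_surj)
  have fa: "f a = a'" "f z = z'" and "map f (concat bs) = concat bs'"
    using fu \<open>length u = length u'\<close> by (auto simp: u_def u'_def)
  have "map (map f) bs = bs'"
  proof (rule concat_injective)
    show "concat (map (map f) bs) = concat bs'"
      using \<open>map f (concat bs) = concat bs'\<close> by (simp add: map_concat)
    show "length (map (map f) bs) = length bs'"
      using len map_eq_imp_length_eq by fastforce
    show "\<forall>(x, y)\<in>set (zip (map (map f) bs) bs'). length x = length y"
      using len by (auto simp: set_zip list_eq_iff_nth_eq)
  qed
  then have bs': "bs' = map (map f) bs" by simp
  have "map f (concat (map rev bs)) = concat (map rev bs')"
    unfolding bs' by (simp add: map_concat rev_map comp_def)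
  then show ?thesis
    using equiv_relabel[OF \<open>bij f\<close>, of "a # concat bs @ [z]" "z # concat (map rev bs) @ [a]"] fa
      \<open>map f (concat bs) = concat bs'\<close>
    by (simp add: block_words_def)
qed

text \<open>The alphabet is a parameter, since the words realising a list of sizes live on it.
  Equality of the sums makes one list realisable exactly if the other is; without it the universally
  quantified part could hold vacuously and would not be transitive.\<close>

definition sizes_equiv :: "nat list \<Rightarrow> 'a::finite itself \<Rightarrow> nat list \<Rightarrow> bool"
    ("(_ \<sim>\<^bsub>_\<^esub> _)" [51, 0, 51] 50) where
  "ns \<sim>\<^bsub>ty\<^esub> ms \<longleftrightarrow> sum_list ns = sum_list ms \<and>
     (\<forall>(a :: 'a) z bs a' z' bs'.
        valid (block_words a z bs) \<and> map length bs = ns \<and>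
        valid (block_words a' z' bs') \<and> map length bs' = ms \<longrightarrow>
        block_words a z bs \<approx> block_words a' z' bs')"

text \<open>It is enough to reach some words with block sizes \<open>ms\<close>; any other words
  with these sizes differ by a relabelling only.\<close>

lemma sizes_equivI:
  fixes ty :: "'a::finite itself"
  assumes "sum_list ns = sum_list ms"
    and "\<And>(a :: 'a) z bs. valid (block_words a z bs) \<Longrightarrow> map length bs = ns \<Longrightarrow>
      \<exists>a' z' bs'. map length bs' = ms \<and> block_words a z bs \<approx> block_words a' z' bs'"
  shows "ns \<sim>\<^bsub>ty\<^esub> ms"
  unfolding sizes_equiv_def
proof (intro conjI allI impI assms(1), elim conjE)
  fix a z a' z' :: 'a and bs bs'
  assume v: "valid (block_words a z bs)" "map length bs = ns"
    and v': "valid (block_words a' z' bs')" "map length bs' = ms"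
  obtain b y cs where "map length cs = ms" "block_words a z bs \<approx> block_words b y cs"
    using assms(2)[OF v] by blast
  with v v' show "block_words a z bs \<approx> block_words a' z' bs'"
    by (metis block_words_equiv equiv_trans valid_equiv)
qed

lemma sizes_equiv_refl [simp]: "ns \<sim>\<^bsub>ty\<^esub> ns"
  by (rule sizes_equivI) (use equiv_refl in blast)+

lemma sizes_equiv_trans [trans]:
  fixes ty :: "'a::finite itself"
  assumes "ns \<sim>\<^bsub>ty\<^esub> ms" "ms \<sim>\<^bsub>ty\<^esub> ls"
  shows "ns \<sim>\<^bsub>ty\<^esub> ls"
proof (rule sizes_equivI)
  show "sum_list ns = sum_list ls"
    using assms by (simp add: sizes_equiv_def)
  fix a z :: 'a and bs
  assume v: "valid (block_words a z bs)" "map length bs = ns"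
  then have "sum_list ms + 2 = CARD('a)" "sum_list ls + 2 = CARD('a)"
    using assms sum_lengths_block_words[OF v(1)] by (auto simp: sizes_equiv_def)
  then obtain a' z' bs' a'' z'' bs''
    where "valid (block_words (a' :: 'a) z' bs')" "map length bs' = ms"
      and "valid (block_words (a'' :: 'a) z'' bs'')" "map length bs'' = ls"
    by (metis ex_block_words)
  moreover from this have "block_words a z bs \<approx> block_words a' z' bs'"
    using assms(1) v unfolding sizes_equiv_def by blast
  moreover from calculation have "block_words a' z' bs' \<approx> block_words a'' z'' bs''"
    using assms(2) unfolding sizes_equiv_def by blast
  ultimately show "\<exists>a' z' bs'. map length bs' = ls \<and> block_words a z bs \<approx> block_words a' z' bs'"
    by (intro exI[of _ a''] exI[of _ z''] exI[of _ bs'']) (auto intro: equiv_trans)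
qed

lemma lengths_appendE:
  assumes "map length bs = ns @ ms"
  obtains cs ds where "bs = cs @ ds" "map length cs = ns" "map length ds = ms"
  using assms by (auto simp: map_eq_append_conv)

lemma rotate_chains_sizes: "ns @ 1 # ms \<sim>\<^bsub>ty\<^esub> ms @ 1 # ns"
proof (rule sizes_equivI)
  fix a z and bs :: "'a list list"
  assume "map length bs = ns @ 1 # ms"
  then have "map length bs = ns @ [1] @ ms"
    by simp
  then obtain X R where X: "bs = X @ R" "map length X = ns" and "map length R = [1] @ ms"
    by (rule lengths_appendE)
  from this(3) obtain K Y where Y: "R = K @ Y" "map length K = [1]" "map length Y = ms"
    by (rule lengths_appendE)
  obtain k where "K = [[k]]"
    using Y(2) by (auto simp: map_eq_Cons_conv length_Suc_conv)
  with X Y(1,3) show "\<exists>a' z' bs'. map length bs' = ms @ 1 # ns \<and> block_words a z bs \<approx> block_words a' z' bs'"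
    using equiv_rotate_chains[of a "concat X" k "concat Y" z "concat (map rev X)" "concat (map rev Y)"]
    by (intro exI[of _ k] exI[of _ z] exI[of _ "Y @ [a] # X"]) (simp add: block_words_def)
qed simp

text \<open>The letter of the first \<open>1\<close>-block and the first letter of the pair exchange
  their roles, so the words are standard again. The second \<open>1\<close>-block, whose letter
  \<open>m\<close> is a winner in \<open>equiv_swap_chains\<close>, requires a possibly empty chain
  \<open>ls\<close> behind the two.\<close>

lemma swap_chains_sizes: "ns @ 1 # ms @ 1 # ls \<sim>\<^bsub>ty\<^esub> ms @ 1 # ns @ 1 # ls"
proof (rule sizes_equivI)
  fix a z and bs :: "'a list list"
  assume "map length bs = ns @ 1 # ms @ 1 # ls"
  then have "map length bs = ns @ [1] @ ms @ [1] @ ls"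
    by simp
  then obtain X R1 where X: "bs = X @ R1" "map length X = ns"
    and R1: "map length R1 = [1] @ ms @ [1] @ ls"
    by (rule lengths_appendE)
  from R1 obtain K R2 where K: "R1 = K @ R2" "map length K = [1]"
    and R2: "map length R2 = ms @ [1] @ ls"
    by (rule lengths_appendE)
  from R2 obtain Y R3 where Y: "R2 = Y @ R3" "map length Y = ms"
    and R3: "map length R3 = [1] @ ls"
    by (rule lengths_appendE)
  from R3 obtain M W where W: "R3 = M @ W" "map length M = [1]" "map length W = ls"
    by (rule lengths_appendE)
  obtain k m where "K = [[k]]" "M = [[m]]"
    using K(2) W(2) by (auto simp: map_eq_Cons_conv length_Suc_conv)
  with X K(1) Y W(1,3) show "\<exists>a' z' bs'. map length bs' = ms @ 1 # ns @ 1 # ls \<and>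
      block_words a z bs \<approx> block_words a' z' bs'"
    using equiv_swap_chains[of a "concat X" k "concat Y" m "concat W" z
        "concat (map rev X)" "concat (map rev Y)" "concat (map rev W)"]
    by (intro exI[of _ k] exI[of _ z] exI[of _ "Y @ [a] # X @ [m] # W"]) (simp add: block_words_def)
qed simp

lemma four_block_sizes:
  "[4] @ ns @ [1, 2, 2] @ ms \<sim>\<^bsub>ty\<^esub> [2, 2] @ ns @ [1, 4] @ ms"
proof (rule sizes_equivI)
  fix a z and bs :: "'a list list"
  assume "map length bs = [4] @ ns @ [1, 2, 2] @ ms"
  then obtain B R1 where B: "bs = B @ R1" "map length B = [4]"
    and R1: "map length R1 = ns @ [1, 2, 2] @ ms"
    by (rule lengths_appendE)
  from R1 obtain X R2 where X: "R1 = X @ R2" "map length X = ns"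
    and R2: "map length R2 = [1, 2, 2] @ ms"
    by (rule lengths_appendE)
  from R2 obtain K Y where K: "R2 = K @ Y" "map length K = [1, 2, 2]" "map length Y = ms"
    by (rule lengths_appendE)
  obtain b c d e k f g h i where "B = [[b, c, d, e]]" "K = [[k], [f, g], [h, i]]"
    using B(2) K(2) by (auto simp: map_eq_Cons_conv length_Suc_conv numeral_eq_Suc)
  with B(1) X K(1,3) show "\<exists>a' z' bs'. map length bs' = [2, 2] @ ns @ [1, 4] @ ms \<and>
      block_words a z bs \<approx> block_words a' z' bs'"
    using equiv_four_block[of a b c d e "concat X" k f g h i "concat Y" z
        "concat (map rev X)" "concat (map rev Y)"]
    by (intro exI[of _ a] exI[of _ z] exI[of _ "[[d, e], [b, c]] @ X @ [[k], [h, i, f, g]] @ Y"])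
      (simp add: block_words_def)
qed simp

section \<open>Peeling off blocks\<close>

text \<open>Read from right to left this is one peeling step, a rotation in each row: the block
  \<open>x # w\<close> leaves the end of the front part \<open>p @ m\<close>, and
  \<open>v @ [y]\<close> is completed to a block behind \<open>l\<close>.\<close>

lemma peel_step:
  "(p @ m @ x # l @ v @ y # w @ [z], l' @ y # v' @ z # q @ m' @ w' @ [x])
    \<approx> (p @ m @ x # w @ z # l @ v @ [y], l' @ y # q @ m' @ w' @ x # v' @ [z])"
proof -
  have "(p @ m @ x # l @ v @ y # w @ [z], l' @ y # v' @ z # q @ m' @ w' @ [x])
      \<approx> (p @ m @ x # w @ z # l @ v @ [y], l' @ y # v' @ z # q @ m' @ w' @ [x])"
    using equiv_BR[of "p @ m" x "l @ v @ [y]" "w @ [z]" "l' @ y # v' @ z # q @ m' @ w'"] by simp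
  also have "\<dots> \<approx> (p @ m @ x # w @ z # l @ v @ [y], l' @ y # q @ m' @ w' @ x # v' @ [z])"
    using equiv_TR[of "p @ m @ x # w @ z # l @ v" y l' "v' @ [z]" "q @ m' @ w' @ [x]"] by simp
  finally show ?thesis .
qed

text \<open>The block in transit is held by \<open>x\<close>, \<open>w\<close>, \<open>y\<close> and
  counts as \<open>Suc (length w)\<close>. Each step completes it as the next entry of
  \<open>cs\<close> and puts the last remaining block of \<open>bs\<close> in its place, so sizes
  come out in reverse order. The words \<open>m\<close>, \<open>m'\<close> collect the blocks in
  front that are still to be peeled.\<close>

lemma peel_iterate:
  assumes "\<forall>b\<in>set bs. b \<noteq> []"
  shows "\<exists>cs x' w' y'. Suc (length w') # rev (map length cs) = map length bs @ [Suc (length w)] \<and>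
    (p @ m @ x' # l @ concat cs @ w' @ [y'], l' @ concat (map rev cs) @ y' # q @ m' @ rev w' @ [x'])
    \<approx> (p @ m @ concat bs @ x # l @ w @ [y], l' @ y # q @ m' @ concat (map rev bs) @ rev w @ [x])"
  using assms
proof (induction bs arbitrary: m m')
  case Nil
  show ?case
    by (intro exI[of _ "[]"] exI[of _ x] exI[of _ w] exI[of _ y]) simp
next
  case (Cons b bs)
  obtain k v where b: "b = k # v"
    using Cons.prems by (cases b) auto
  obtain cs x' w' y' where IH:
    "Suc (length w') # rev (map length cs) = map length bs @ [Suc (length w)]"
    "(p @ (m @ b) @ x' # l @ concat cs @ w' @ [y'],
        l' @ concat (map rev cs) @ y' # q @ (m' @ rev b) @ rev w' @ [x'])
      \<approx> (p @ (m @ b) @ concat bs @ x # l @ w @ [y],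
        l' @ y # q @ (m' @ rev b) @ concat (map rev bs) @ rev w @ [x])"
    using Cons.IH[of "m @ b" "m' @ rev b"] Cons.prems by auto
  have "(p @ m @ k # l @ concat (cs @ [w' @ [y']]) @ v @ [x'],
        l' @ concat (map rev (cs @ [w' @ [y']])) @ x' # q @ m' @ rev v @ [k])
      \<approx> (p @ (m @ b) @ x' # l @ concat cs @ w' @ [y'],
        l' @ concat (map rev cs) @ y' # q @ (m' @ rev b) @ rev w' @ [x'])"
    using peel_step[of p m k "l @ concat cs" w' y' v x' "l' @ concat (map rev cs)" "rev w'" q m' "rev v"]
    by (simp add: b)
  also note IH(2)
  finally have "(p @ m @ k # l @ concat (cs @ [w' @ [y']]) @ v @ [x'],
        l' @ concat (map rev (cs @ [w' @ [y']])) @ x' # q @ m' @ rev v @ [k])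
      \<approx> (p @ m @ concat (b # bs) @ x # l @ w @ [y],
        l' @ y # q @ m' @ concat (map rev (b # bs)) @ rev w @ [x])"
    by simp
  moreover have "Suc (length v) # rev (map length (cs @ [w' @ [y']])) = map length (b # bs) @ [Suc (length w)]"
    using IH(1) by (simp add: b)
  ultimately show ?case by blast
qed

text \<open>The common last letter \<open>c\<close> is the winner that allows the first row to be
  rotated in \<open>peel_start\<close>; if both words are empty, the first letter \<open>a\<close>
  takes its place.\<close>

definition same_end :: "'a list \<Rightarrow> 'a list \<Rightarrow> bool" where
  "same_end p q \<longleftrightarrow> p = [] \<and> q = [] \<or> (\<exists>p' q' c. p = p' @ [c] \<and> q = q' @ [c])"

text \<open>Read from right to left this ends a peeling: the block in transit settles as
  \<open>v @ [y]\<close>, and \<open>z\<close> becomes the last letter above and the first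
  below.\<close>

lemma peel_start:
  assumes "same_end p q"
  shows "(a # p @ l @ v @ y # [z], z # q @ l' @ y # v' @ [a])
    \<approx> (a # p @ z # l @ v @ [y], l' @ y # a # q @ v' @ [z])"
proof -
  have last: "(a # p @ z # l @ v @ [y], l' @ y # v' @ z # a # q) \<approx>
      (a # p @ z # l @ v @ [y], l' @ y # a # q @ v' @ [z])"
    using equiv_TR[of "a # p @ z # l @ v" y l' "v' @ [z]" "a # q"] by simp
  consider "p = []" "q = []" | p' q' c where "p = p' @ [c]" "q = q' @ [c]"
    using assms by (auto simp: same_end_def)
  then show ?thesis
  proof cases
    case 1
    have "(a # l @ v @ y # [z], z # l' @ y # v' @ [a]) \<approx> (a # l @ v @ y # [z], l' @ y # v' @ [z, a])"
      using equiv_TL[of a "l @ v @ y # [z]" "[z]" "l' @ y # v'" "[]"] by simp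
    also have "\<dots> \<approx> (a # z # l @ v @ [y], l' @ y # v' @ [z, a])"
      using equiv_BR[of "[]" a "l @ v @ [y]" "[z]" "l' @ y # v' @ [z]"] by simp
    finally show ?thesis
      using last by (auto simp: 1 intro: equiv_trans)
  next
    case 2
    have "(a # p @ l @ v @ y # [z], z # q @ l' @ y # v' @ [a])
        \<approx> (a # p @ l @ v @ y # [z], z # l' @ y # v' @ a # q)"
      using equiv_TR[of "a # p @ l @ v @ [y]" z "[]" q "l' @ y # v' @ [a]"] by simp
    also have "\<dots> \<approx> (a # p @ l @ v @ y # [z], l' @ y # v' @ z # a # q)"
      using equiv_TL[of a "p @ l @ v @ y # [z]" "[z]" "l' @ y # v'" q] by simp
    also have "\<dots> \<approx> (a # p @ z # l @ v @ [y], l' @ y # v' @ z # a # q)"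
      using equiv_BR[of "a # p'" c "l @ v @ [y]" "[z]" "l' @ y # v' @ z # a # q'"] by (simp add: 2)
    finally show ?thesis
      using last by (rule equiv_trans)
  qed
qed

text \<open>The blocks are \<open>bs\<close> and a last one \<open>x # w\<close>. The words
  \<open>l\<close> and \<open>l'\<close> are overtaken by all of them and end up directly behind
  \<open>p\<close> and \<open>q\<close>; with one letter each they can complete a
  \<open>3\<close>-block whose first two letters close \<open>p\<close> and
  \<open>q\<close>.\<close>

lemma peel_blocks:
  assumes "same_end p q" "\<forall>b\<in>set bs. b \<noteq> []"
  obtains cs z where "map length cs = rev (map length bs @ [Suc (length w)])"
    "(a # p @ concat bs @ x # l @ w @ [y], y # q @ concat (map rev bs) @ rev w @ x # l' @ [a])
      \<approx> (a # p @ l @ concat cs @ [z], z # q @ l' @ concat (map rev cs) @ [a])"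
proof -
  obtain cs x' w' y' where *:
    "Suc (length w') # rev (map length cs) = map length bs @ [Suc (length w)]"
    "((a # p) @ [] @ x' # l @ concat cs @ w' @ [y'],
        l' @ concat (map rev cs) @ y' # (a # q) @ [] @ rev w' @ [x'])
    \<approx> ((a # p) @ [] @ concat bs @ x # l @ w @ [y],
        l' @ y # (a # q) @ [] @ concat (map rev bs) @ rev w @ [x])"
    using peel_iterate[OF assms(2)] by meson
  have "(a # p @ concat bs @ x # l @ w @ [y], y # q @ concat (map rev bs) @ rev w @ x # l' @ [a])
      \<approx> (a # p @ concat bs @ x # l @ w @ [y], l' @ y # q @ concat (map rev bs) @ rev w @ [x, a])"
    using equiv_TL[of a "p @ concat bs @ x # l @ w @ [y]" "y # q @ concat (map rev bs) @ rev w @ [x]" l' "[]"]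
    by simp
  also have "\<dots> \<approx> (a # p @ concat bs @ x # l @ w @ [y], l' @ y # a # q @ concat (map rev bs) @ rev w @ [x])"
    using equiv_TR[of "a # p @ concat bs @ x # l @ w" y l' "q @ concat (map rev bs) @ rev w @ [x]" "[a]"]
    by simp
  also have "\<dots> \<approx> (a # p @ x' # l @ concat cs @ w' @ [y'],
        l' @ concat (map rev cs) @ y' # a # q @ rev w' @ [x'])"
    using equiv_sym[OF *(2)] by simp
  also have "\<dots> \<approx> (a # p @ l @ concat cs @ w' @ [y', x'],
        x' # q @ l' @ concat (map rev cs) @ y' # rev w' @ [a])"
    using equiv_sym[OF peel_start[OF assms(1), of a "l @ concat cs" w' y' x' "l' @ concat (map rev cs)" "rev w'"]]
    by simp
  finally have "(a # p @ concat bs @ x # l @ w @ [y], y # q @ concat (map rev bs) @ rev w @ x # l' @ [a])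
      \<approx> (a # p @ l @ concat (cs @ [w' @ [y']]) @ [x'],
        x' # q @ l' @ concat (map rev (cs @ [w' @ [y']])) @ [a])"
    by simp
  moreover have "map length (cs @ [w' @ [y']]) = rev (map length bs @ [Suc (length w)])"
    using *(1) by (metis rev.simps(2) rev_rev_ident length_append_singleton list.simps(8,9) map_append rev_map)
  ultimately show thesis
    using that by blast
qed

lemma mset_concat_map_rev: "mset (concat (map rev bs)) = mset (concat bs)"
  by (induction bs) auto

text \<open>With \<open>l\<close> and \<open>l'\<close> empty both ends are standard. The hypothesis
  on \<open>cs\<close> holds in the two cases used: \<open>cs\<close> is empty, or it ends with a
  \<open>1\<close>-block.\<close>

lemma peel_reverse:
  assumes "same_end (concat cs) (concat (map rev cs))" "\<forall>b\<in>set bs. b \<noteq> []"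
  obtains ds z' where "map length ds = rev (map length bs)"
    "block_words a z (cs @ bs) \<approx> block_words a z' (cs @ ds)"
proof (cases bs rule: rev_cases)
  case Nil
  then show thesis
    using that[of "[]" z] by simp
next
  case (snoc bs' b)
  then obtain x w where b: "b = x # w"
    using assms(2) by (cases b) auto
  have ne: "\<forall>b\<in>set bs'. b \<noteq> []"
    using assms(2) snoc by simp
  obtain ds z' where "map length ds = rev (map length bs' @ [Suc (length w)])"
    "(a # concat cs @ concat bs' @ x # [] @ w @ [z],
        z # concat (map rev cs) @ concat (map rev bs') @ rev w @ x # [] @ [a])
      \<approx> (a # concat cs @ [] @ concat ds @ [z'], z' # concat (map rev cs) @ [] @ concat (map rev ds) @ [a])"
    by (rule peel_blocks[OF assms(1) ne])
  then show thesis
    by (intro that[of ds z']) (simp_all add: snoc b block_words_def)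
qed

lemma reverse_sizes:
  assumes "\<forall>n\<in>set ms. 0 < n"
  shows "ms \<sim>\<^bsub>ty\<^esub> rev ms" and "ns @ 1 # ms \<sim>\<^bsub>ty\<^esub> ns @ 1 # rev ms"
proof -
  show "ms \<sim>\<^bsub>ty\<^esub> rev ms"
  proof (rule sizes_equivI)
    fix a z and bs :: "'a list list"
    assume bs: "map length bs = ms"
    then have ne: "\<forall>b\<in>set bs. b \<noteq> []"
      using assms by auto
    have "same_end (concat []) (concat (map rev [] :: 'a list list))"
      by (simp add: same_end_def)
    then obtain ds z' where "map length ds = rev (map length bs)"
      "block_words a z ([] @ bs) \<approx> block_words a z' ([] @ ds)"
      by (rule peel_reverse[OF _ ne])
    then show "\<exists>a' z' bs'. map length bs' = rev ms \<and> block_words a z bs \<approx> block_words a' z' bs'"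
      using bs by auto
  qed simp
  show "ns @ 1 # ms \<sim>\<^bsub>ty\<^esub> ns @ 1 # rev ms"
  proof (rule sizes_equivI)
    fix a z and bs :: "'a list list"
    assume "map length bs = ns @ 1 # ms"
    then have "map length bs = ns @ [1] @ ms"
      by simp
    then obtain X R where X: "bs = X @ R" "map length X = ns" and "map length R = [1] @ ms"
      by (rule lengths_appendE)
    from this(3) obtain K Y where Y: "R = K @ Y" "map length K = [1]" "map length Y = ms"
      by (rule lengths_appendE)
    obtain k where k: "K = [[k]]"
      using Y(2) by (auto simp: map_eq_Cons_conv length_Suc_conv)
    have se: "same_end (concat (X @ [[k]])) (concat (map rev (X @ [[k]])))"
      unfolding same_end_def by simp
    have ne: "\<forall>b\<in>set Y. b \<noteq> []"
      using assms Y(3) by auto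
    obtain ds z' where "map length ds = rev (map length Y)"
      "block_words a z ((X @ [[k]]) @ Y) \<approx> block_words a z' ((X @ [[k]]) @ ds)"
      by (rule peel_reverse[OF se ne])
    then show "\<exists>a' z' bs'. map length bs' = ns @ 1 # rev ms \<and> block_words a z bs \<approx> block_words a' z' bs'"
      using X Y k by (intro exI[of _ a] exI[of _ z'] exI[of _ "X @ [k] # ds"]) simp
  qed simp
qed

text \<open>Peeling the \<open>2\<close>-blocks off the last chain at the middle letter of its \<open>3\<close>-block leads to words that
  also arise, with the rows exchanged, when \<open>ns\<close> and \<open>ls\<close> are interchanged.\<close>

lemma three_block_sizes:
  fixes ty :: "'a::finite itself"
  shows "ns @ [3] @ ms @ [1] @ ls @ [3] @ replicate (Suc n) 2
    \<sim>\<^bsub>ty\<^esub> ls @ [3] @ ms @ [1] @ ns @ [3] @ replicate (Suc n) 2"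
    (is "?L \<sim>\<^bsub>ty\<^esub> ?R")
proof -
  have "block_words a0 z0 bs \<approx> block_words a' z' bs'"
    if v: "valid (block_words (a0 :: 'a) z0 bs)" "map length bs = ?L"
      and v': "valid (block_words (a' :: 'a) z' bs')" "map length bs' = ?R" for a0 z0 bs a' z' bs'
  proof -
    \<comment> \<open>Only the first row of these words is used, as a supply of letters cut like the
      word \<open>m\<close> below, in which \<open>c\<close> has been moved from the block
      \<open>a b c\<close> into the last piece \<open>x c w\<close>.\<close>
    have "sum_list (ns @ [3] @ ms @ [1] @ ls @ [2] @ replicate n 2 @ [3]) + 2 = CARD('a)"
      using sum_lengths_block_words[OF v(1)] by (simp add: v(2))
    then obtain A y :: 'a and cs where cs: "valid (block_words A y cs)"
      "map length cs = ns @ [3] @ ms @ [1] @ ls @ [2] @ replicate n 2 @ [3]"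
      by (rule ex_block_words)
    from cs(2) obtain P T1 where P: "cs = P @ T1" "map length P = ns"
      and "map length T1 = [3] @ ms @ [1] @ ls @ [2] @ replicate n 2 @ [3]"
      by (rule lengths_appendE)
    from this(3) obtain B1 T2 where B1: "T1 = B1 @ T2" "map length B1 = [3]"
      and "map length T2 = ms @ [1] @ ls @ [2] @ replicate n 2 @ [3]"
      by (rule lengths_appendE)
    from this(3) obtain R T3 where R: "T2 = R @ T3" "map length R = ms"
      and "map length T3 = [1] @ ls @ [2] @ replicate n 2 @ [3]"
      by (rule lengths_appendE)
    from this(3) obtain B2 T4 where B2: "T3 = B2 @ T4" "map length B2 = [1]"
      and "map length T4 = ls @ [2] @ replicate n 2 @ [3]"
      by (rule lengths_appendE)
    from this(3) obtain Q T5 where Q: "T4 = Q @ T5" "map length Q = ls"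
      and "map length T5 = [2] @ replicate n 2 @ [3]"
      by (rule lengths_appendE)
    from this(3) obtain B3 T6 where B3: "T5 = B3 @ T6" "map length B3 = [2]"
      and "map length T6 = replicate n 2 @ [3]"
      by (rule lengths_appendE)
    from this(3) obtain N B4 where B4: "T6 = N @ B4" "map length N = replicate n 2" "map length B4 = [3]"
      by (rule lengths_appendE)
    obtain s t u k a b x c w where "B1 = [[s, t, u]]" "B2 = [[k]]" "B3 = [[a, b]]" "B4 = [[x, c, w]]"
      using B1(2) B2(2) B3(2) B4(3) by (auto simp: map_eq_Cons_conv length_Suc_conv numeral_eq_Suc)
    then have decomp: "cs = P @ [[s, t, u]] @ R @ [[k]] @ Q @ [[a, b]] @ N @ [[x, c, w]]"
      by (simp add: P(1) B1(1) R(1) B2(1) Q(1) B3(1) B4(1))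
    note len = P(2) R(2) Q(2) B4(2)
    have N: "\<forall>b\<in>set N. b \<noteq> []"
    proof
      fix d assume "d \<in> set N"
      then have "length d \<in> set (map length N)"
        by simp
      then show "d \<noteq> []"
        by (auto simp: len(4))
    qed
    \<comment> \<open>The word from which both peelings start: the left-hand side of
      \<open>equiv_three_block\<close>. Its second row is not that of the block words of
      \<open>cs\<close>, so its validity has to be derived anew.\<close>
    define m where "m = (A # concat P @ s # t # u # concat R @ k # concat Q @ a # b # concat N @ x # c # w # [y],
      y # concat (map rev P) @ u # t # s # concat (map rev R) @ k # concat (map rev Q) @ c # b #
        concat (map rev N) @ w # x # a # [A])"
    have "valid_word (fst m)"
      using cs(1) by (simp add: m_def decomp block_words_def)
    moreover have "mset (fst m) = mset (snd m)"
      by (simp add: m_def mset_concat_map_rev)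
    ultimately have "valid_word (snd m)"
      unfolding valid_word_def by (metis mset_eq_imp_distinct_iff mset_eq_setD)
    with \<open>valid_word (fst m)\<close> have "valid m"
      by (cases m) simp
    have "same_end (concat P @ s # t # u # concat R @ k # concat Q @ [a, b])
      (concat (map rev P) @ u # t # s # concat (map rev R) @ k # concat (map rev Q) @ [c, b])"
      unfolding same_end_def
      by (intro disjI2 exI[of _ b] exI[of _ "concat P @ s # t # u # concat R @ k # concat Q @ [a]"]
          exI[of _ "concat (map rev P) @ u # t # s # concat (map rev R) @ k # concat (map rev Q) @ [c]"]) simp
    \<comment> \<open>Here \<open>l\<close> is \<open>[c]\<close> and \<open>l'\<close> is
      \<open>[a]\<close>. Behind \<open>a b\<close> above and \<open>c b\<close> below they complete
      the \<open>3\<close>-block \<open>a b c\<close>.\<close>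
    from peel_blocks[OF this N, of "[w]" A x "[c]" y "[a]"]
    obtain C z1 where C: "map length C = rev (map length N @ [Suc (Suc 0)])"
      "m \<approx> block_words A z1 (P @ [s, t, u] # R @ [k] # Q @ [a, b, c] # C)"
      by (auto simp: m_def block_words_def)
    have "same_end (concat (map rev Q) @ c # t # a # concat (map rev R) @ y # concat (map rev P) @ [u, A])
      (concat Q @ a # t # c # concat R @ y # concat P @ [s, A])"
      unfolding same_end_def
      by (intro disjI2 exI[of _ A] exI[of _ "concat (map rev Q) @ c # t # a # concat (map rev R) @ y # concat (map rev P) @ [u]"]
          exI[of _ "concat Q @ a # t # c # concat R @ y # concat P @ [s]"]) simp
    \<comment> \<open>Rows exchanged, with \<open>l = [s]\<close> and \<open>l' = [u]\<close>: these
      letters complete the \<open>3\<close>-block of \<open>s\<close>, \<open>A\<close>,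
      \<open>u\<close>, and the blocks of \<open>N\<close> enter reversed.\<close>
    from peel_blocks[OF this, of "map rev N" "[x]" b w "[s]" k "[u]"] N
    obtain D z2 where D: "map length D = rev (map length N @ [Suc (Suc 0)])"
      "(b # concat (map rev Q) @ c # t # a # concat (map rev R) @ y # concat (map rev P) @ u # A #
          concat (map rev N) @ w # s # x # [k],
        k # concat Q @ a # t # c # concat R @ y # concat P @ s # A # concat N @ x # w # u # [b])
      \<approx> (b # concat (map rev Q) @ c # t # a # concat (map rev R) @ y # concat (map rev P) @ u # A # s #
          concat D @ [z2],
        z2 # concat Q @ a # t # c # concat R @ y # concat P @ s # A # u # concat (map rev D) @ [b])"
      by (auto simp: comp_def)
    have "block_words A z1 (P @ [s, t, u] # R @ [k] # Q @ [a, b, c] # C) \<approx> m"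
      by (rule equiv_sym[OF C(2)])
    also have "m \<approx> (k # concat Q @ a # t # c # concat R @ y # concat P @ s # A # concat N @ x # w # u # [b],
      b # concat (map rev Q) @ c # t # a # concat (map rev R) @ y # concat (map rev P) @ u # A #
          concat (map rev N) @ w # s # x # [k])"
      unfolding m_def by (rule equiv_three_block)
    also have "\<dots> \<approx> block_words z2 b (Q @ [a, t, c] # R @ [y] # P @ [s, A, u] # map rev D)"
      using equiv_swap_rows[OF D(2)] by (simp add: block_words_def comp_def)
    finally have eq: "block_words A z1 (P @ [s, t, u] # R @ [k] # Q @ [a, b, c] # C)
      \<approx> block_words z2 b (Q @ [a, t, c] # R @ [y] # P @ [s, A, u] # map rev D)" .
    have twos: "rev (map length N @ [Suc (Suc 0)]) = replicate (Suc n) 2"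
      by (simp add: len numeral_2_eq_2 replicate_append_same)
    have LR: "map length (P @ [s, t, u] # R @ [k] # Q @ [a, b, c] # C) = ?L"
      "map length (Q @ [a, t, c] # R @ [y] # P @ [s, A, u] # map rev D) = ?R"
      using C(1) D(1) twos by (simp_all add: len comp_def)
    have w: "valid (block_words A z1 (P @ [s, t, u] # R @ [k] # Q @ [a, b, c] # C))"
      using valid_equiv[OF C(2) \<open>valid m\<close>] .
    have "block_words a0 z0 bs \<approx> block_words A z1 (P @ [s, t, u] # R @ [k] # Q @ [a, b, c] # C)"
      by (rule block_words_equiv[OF v(1) w]) (simp only: v(2) LR)
    also note eq
    also have "block_words z2 b (Q @ [a, t, c] # R @ [y] # P @ [s, A, u] # map rev D) \<approx> block_words a' z' bs'"
      by (rule block_words_equiv[OF valid_equiv[OF eq w] v'(1)]) (simp only: v'(2) LR)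
    finally show ?thesis .
  qed
  then show ?thesis
    by (auto simp: sizes_equiv_def)
qed

section \<open>Chains\<close>

fun join_chains :: "nat list list \<Rightarrow> nat list" where
  "join_chains [] = []"
| "join_chains [c] = c"
| "join_chains (c # d # ds) = c @ 1 # join_chains (d # ds)"

lemma join_chains_Cons: "cs \<noteq> [] \<Longrightarrow> join_chains (c # cs) = c @ 1 # join_chains cs"
  by (cases cs) auto

lemma join_chains_append:
  "cs \<noteq> [] \<Longrightarrow> ds \<noteq> [] \<Longrightarrow> join_chains (cs @ ds) = join_chains cs @ 1 # join_chains ds"
  by (induction cs rule: join_chains.induct) (auto simp: join_chains_Cons)

lemma join_chains_snoc_append: "join_chains (cs @ [c @ d]) = join_chains (cs @ [c]) @ d"
proof (cases "cs = []")
  case False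
  then show ?thesis
    by (simp add: join_chains_append)
qed simp

lemma chains_nonempty [simp]: "chains ns \<noteq> []"
  by (induction ns) (auto simp: Let_def)

lemma join_chains_chains [simp]: "join_chains (chains ns) = ns"
proof (induction ns)
  case (Cons n ns)
  obtain c cs where cs: "chains ns = c # cs"
    by (meson chains_nonempty neq_Nil_conv)
  with Cons.IH show ?case
    by (cases cs) (auto simp: Let_def)
qed simp

definition chains_equiv :: "nat list list \<Rightarrow> 'a::finite itself \<Rightarrow> nat list list \<Rightarrow> bool"
    ("(_ \<simeq>\<^bsub>_\<^esub> _)" [51, 0, 51] 50) where
  "cs \<simeq>\<^bsub>ty\<^esub> ds \<longleftrightarrow> join_chains cs \<sim>\<^bsub>ty\<^esub> join_chains ds"

lemma chains_equiv_refl [simp]: "cs \<simeq>\<^bsub>ty\<^esub> cs"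
  by (simp add: chains_equiv_def)

lemma chains_equiv_trans [trans]: "cs \<simeq>\<^bsub>ty\<^esub> ds \<Longrightarrow> ds \<simeq>\<^bsub>ty\<^esub> es \<Longrightarrow> cs \<simeq>\<^bsub>ty\<^esub> es"
  unfolding chains_equiv_def by (rule sizes_equiv_trans)

lemma rotate_chains: "cs @ ds \<simeq>\<^bsub>ty\<^esub> ds @ cs"
  by (cases "cs = [] \<or> ds = []")
    (auto simp: chains_equiv_def join_chains_append intro: rotate_chains_sizes[unfolded One_nat_def])

text \<open>\<open>swap_chains_sizes\<close> wants the two chains in front and another one behind
  them. A rotation brings them to the front; if there is no other chain, the rotation is itself the
  swap.\<close>

lemma swap_chains: "cs @ c # d # ds \<simeq>\<^bsub>ty\<^esub> cs @ d # c # ds"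
proof (cases "ds @ cs = []")
  case True
  then show ?thesis
    using rotate_chains[of "[c]" "[d]"] by simp
next
  case False
  have "cs @ (c # d # ds) \<simeq>\<^bsub>ty\<^esub> (c # d # ds) @ cs"
    by (rule rotate_chains)
  also have "(c # d # ds) @ cs \<simeq>\<^bsub>ty\<^esub> (d # c # ds) @ cs"
    using False swap_chains_sizes[of c d "join_chains (ds @ cs)"]
    by (simp add: chains_equiv_def join_chains_Cons)
  also have "(d # c # ds) @ cs \<simeq>\<^bsub>ty\<^esub> cs @ d # c # ds"
    by (rule rotate_chains)
  finally show ?thesis .
qed

lemma move_chain: "ps @ cs @ d # ds \<simeq>\<^bsub>ty\<^esub> ps @ d # cs @ ds"
proof (induction cs arbitrary: ps)
  case (Cons c cs)
  have "ps @ (c # cs) @ d # ds \<simeq>\<^bsub>ty\<^esub> ps @ c # d # cs @ ds"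
    using Cons.IH[of "ps @ [c]"] by simp
  also have "\<dots> \<simeq>\<^bsub>ty\<^esub> ps @ d # (c # cs) @ ds"
    using swap_chains[of ps c d "cs @ ds"] by simp
  finally show ?case .
qed simp

lemma permute_chains_append: "mset cs = mset ds \<Longrightarrow> ps @ cs \<simeq>\<^bsub>ty\<^esub> ps @ ds"
proof (induction ds arbitrary: cs ps)
  case (Cons d ds)
  then have "d \<in> set cs"
    by (metis list.set_intros(1) mset_eq_setD)
  then obtain es fs where cs: "cs = es @ d # fs"
    by (meson split_list)
  have "ps @ cs \<simeq>\<^bsub>ty\<^esub> (ps @ [d]) @ es @ fs"
    using move_chain[of ps es d fs] by (simp add: cs)
  also have "\<dots> \<simeq>\<^bsub>ty\<^esub> (ps @ [d]) @ ds"
    by (rule Cons.IH) (use Cons.prems cs in simp)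
  finally show ?case by simp
qed simp

lemma permute_chains: "mset cs = mset ds \<Longrightarrow> cs \<simeq>\<^bsub>ty\<^esub> ds"
  using permute_chains_append[of cs ds "[]"] by simp

lemma reverse_last_chain: "\<forall>n\<in>set c. 0 < n \<Longrightarrow> cs @ [c] \<simeq>\<^bsub>ty\<^esub> cs @ [rev c]"
  using reverse_sizes[of c] by (cases "cs = []") (simp_all add: chains_equiv_def join_chains_append)

lemma reverse_chain:
  assumes "\<forall>n\<in>set c. 0 < n"
  shows "cs @ c # ds \<simeq>\<^bsub>ty\<^esub> cs @ rev c # ds"
proof -
  have "cs @ c # ds \<simeq>\<^bsub>ty\<^esub> (cs @ ds) @ [c]"
    by (rule permute_chains) simp
  also have "\<dots> \<simeq>\<^bsub>ty\<^esub> (cs @ ds) @ [rev c]"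
    by (rule reverse_last_chain[OF assms])
  also have "\<dots> \<simeq>\<^bsub>ty\<^esub> cs @ rev c # ds"
    by (rule permute_chains) simp
  finally show ?thesis .
qed

section \<open>Chains containing a 3-block, and the chain with a 4-block\<close>

fun three_chain :: "nat \<times> nat \<Rightarrow> nat list" where
  "three_chain (m, l) = replicate m 2 @ [3] @ replicate l 2"

lemma reverse_three_chain: "cs @ three_chain (m, l) # ds \<simeq>\<^bsub>ty\<^esub> cs @ three_chain (l, m) # ds"
proof -
  have "\<forall>n\<in>set (three_chain (m, l)). 0 < n"
    by auto
  from reverse_chain[OF this, of cs ds ty] show ?thesis
    by simp
qed

text \<open>\<open>three_block_sizes\<close> exchanges all that precedes the two
  \<open>3\<close>-blocks, so \<open>cs\<close> travels along with the \<open>a\<close> blocks and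
  is put back by permuting chains. \<open>Suc d\<close> reflects the \<open>2\<close>-block that
  must follow the last \<open>3\<close>-block there.\<close>

lemma re_pair_three_chains_Suc:
  "cs @ [three_chain (a, b), three_chain (c, Suc d)]
    \<simeq>\<^bsub>ty\<^esub> cs @ [three_chain (c, b), three_chain (a, Suc d)]"
proof -
  have join: "join_chains (cs @ [three_chain (a, b)]) = join_chains (cs @ [replicate a 2]) @ [3] @ replicate b 2"
    for cs a b
    using join_chains_snoc_append[of cs "replicate a 2" "[3] @ replicate b 2"] by simp
  have 1: "join_chains (cs @ [three_chain (a, b), three_chain (c, Suc d)]) =
      join_chains (cs @ [replicate a 2]) @ [3] @ replicate b 2 @ [1] @ replicate c 2 @ [3] @ replicate (Suc d) 2"
    using join[of cs a b] join_chains_append[of "cs @ [three_chain (a, b)]" "[three_chain (c, Suc d)]"]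
    by simp
  have 2: "join_chains (three_chain (c, b) # cs @ [three_chain (a, Suc d)]) =
      replicate c 2 @ [3] @ replicate b 2 @ [1] @ join_chains (cs @ [replicate a 2]) @ [3] @ replicate (Suc d) 2"
    using join[of cs a "Suc d"] by (simp add: join_chains_Cons)
  have "cs @ [three_chain (a, b), three_chain (c, Suc d)] \<simeq>\<^bsub>ty\<^esub> three_chain (c, b) # cs @ [three_chain (a, Suc d)]"
    unfolding chains_equiv_def 1 2 by (rule three_block_sizes)
  also have "\<dots> \<simeq>\<^bsub>ty\<^esub> cs @ [three_chain (c, b), three_chain (a, Suc d)]"
    by (rule permute_chains) simp
  finally show ?thesis .
qed

text \<open>If \<open>d = 0\<close> but \<open>b\<close> is not, the two chains are interchanged so
  that the nonzero number stands at the end; if both vanish, the claim is a permutation.\<close>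

lemma re_pair_three_chains:
  "cs @ [three_chain (a, b), three_chain (c, d)] \<simeq>\<^bsub>ty\<^esub> cs @ [three_chain (c, b), three_chain (a, d)]"
proof (cases d)
  case (Suc d')
  then show ?thesis
    using re_pair_three_chains_Suc by metis
next
  case d: 0
  show ?thesis
  proof (cases b)
    case 0
    then show ?thesis
      by (intro permute_chains) (simp add: d)
  next
    case (Suc b')
    have "cs @ [three_chain (a, b), three_chain (c, d)] \<simeq>\<^bsub>ty\<^esub> cs @ [three_chain (c, d), three_chain (a, Suc b')]"
      by (rule permute_chains) (simp add: Suc)
    also have "\<dots> \<simeq>\<^bsub>ty\<^esub> cs @ [three_chain (a, d), three_chain (c, Suc b')]"
      by (rule re_pair_three_chains_Suc)
    also have "\<dots> \<simeq>\<^bsub>ty\<^esub> cs @ [three_chain (c, b), three_chain (a, d)]"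
      by (rule permute_chains) (simp add: Suc)
    finally show ?thesis .
  qed
qed

text \<open>The numbers of \<open>2\<close>-blocks on the sides of the \<open>3\<close>-blocks with
  the pairing forgotten, which is all that the cycle lengths retain.\<close>

definition flat :: "('b \<times> 'b) list \<Rightarrow> 'b multiset" where
  "flat ps = mset (map fst ps) + mset (map snd ps)"

lemma flat_simps [simp]: "flat [] = {#}" "flat ((a, b) # ps) = {#a, b#} + flat ps"
  by (simp_all add: flat_def)

lemma extract_three_chain:
  assumes "x \<in># flat ps"
  shows "\<exists>y ps'. flat ps = {#x, y#} + flat ps' \<and>
    (\<forall>cs. cs @ map three_chain ps \<simeq>\<^bsub>ty\<^esub> cs @ three_chain (x, y) # map three_chain ps')"
proof -
  consider y where "(x, y) \<in> set ps" | y where "(y, x) \<in> set ps"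
    using assms by (auto simp: flat_def)
  then obtain y p where p: "p \<in> set ps" "p = (x, y) \<or> p = (y, x)"
    by metis
  then obtain as bs where ps: "ps = as @ p # bs"
    by (meson split_list)
  have "flat ps = {#x, y#} + flat (as @ bs)"
    using p(2) by (auto simp: ps flat_def)
  moreover have "cs @ map three_chain ps \<simeq>\<^bsub>ty\<^esub> cs @ three_chain (x, y) # map three_chain (as @ bs)" for cs
  proof -
    have "cs @ map three_chain ps \<simeq>\<^bsub>ty\<^esub> cs @ three_chain p # map three_chain (as @ bs)"
      by (rule permute_chains) (simp add: ps)
    also have "\<dots> \<simeq>\<^bsub>ty\<^esub> cs @ three_chain (x, y) # map three_chain (as @ bs)"
      using p(2) reverse_three_chain by (auto simp del: three_chain.simps)
    finally show ?thesis .
  qed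
  ultimately show ?thesis
    by blast
qed

text \<open>The pairs of \<open>qs\<close> are produced one by one. To obtain \<open>(c, d)\<close>,
  take the partner \<open>b\<close> of \<open>c\<close> and, if it differs from \<open>d\<close>,
  the partner \<open>a\<close> of \<open>d\<close>; re-pairing turns \<open>(c, b)\<close>,
  \<open>(a, d)\<close> into \<open>(a, b)\<close>, \<open>(c, d)\<close>.\<close>

lemma three_chains_equiv:
  "flat ps = flat qs \<Longrightarrow> cs @ map three_chain ps \<simeq>\<^bsub>ty\<^esub> cs @ map three_chain qs"
proof (induction qs arbitrary: ps cs)
  case Nil
  then have "ps = []"
    by (simp add: flat_def)
  then show ?case by simp
next
  case (Cons q qs)
  obtain c d where q: "q = (c, d)" by force
  have "c \<in># flat ps"
    by (simp add: Cons.prems q)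
  then obtain b ps1 where ps1: "flat ps = {#c, b#} + flat ps1"
    "\<And>cs. cs @ map three_chain ps \<simeq>\<^bsub>ty\<^esub> cs @ three_chain (c, b) # map three_chain ps1"
    using extract_three_chain[of c ps ty] by blast
  have eq: "{#d#} + flat qs = {#b#} + flat ps1"
    using ps1(1) Cons.prems by (simp add: q)
  show ?case
  proof (cases "d = b")
    case True
    have "cs @ map three_chain ps \<simeq>\<^bsub>ty\<^esub> (cs @ [three_chain (c, d)]) @ map three_chain ps1"
      using ps1(2) by (simp add: True)
    also have "\<dots> \<simeq>\<^bsub>ty\<^esub> (cs @ [three_chain (c, d)]) @ map three_chain qs"
      by (rule Cons.IH) (use eq True in simp)
    finally show ?thesis
      by (simp add: q)
  next
    case False
    have "d \<in># {#b#} + flat ps1"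
      using arg_cong[OF eq, of "\<lambda>M. d \<in># M"] by simp
    with False have "d \<in># flat ps1" by simp
    then obtain a ps2 where ps2: "flat ps1 = {#d, a#} + flat ps2"
      "\<And>cs. cs @ map three_chain ps1 \<simeq>\<^bsub>ty\<^esub> cs @ three_chain (d, a) # map three_chain ps2"
      using extract_three_chain[of d ps1 ty] by blast
    let ?r = "map three_chain ps2"
    have "cs @ map three_chain ps \<simeq>\<^bsub>ty\<^esub> (cs @ [three_chain (c, b)]) @ map three_chain ps1"
      using ps1(2) by simp
    also have "\<dots> \<simeq>\<^bsub>ty\<^esub> (cs @ [three_chain (c, b)]) @ three_chain (d, a) # ?r"
      by (rule ps2(2))
    also have "\<dots> \<simeq>\<^bsub>ty\<^esub> (cs @ [three_chain (c, b)]) @ three_chain (a, d) # ?r"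
      by (rule reverse_three_chain)
    also have "\<dots> \<simeq>\<^bsub>ty\<^esub> (cs @ ?r) @ [three_chain (c, b), three_chain (a, d)]"
      by (rule permute_chains) simp
    also have "\<dots> \<simeq>\<^bsub>ty\<^esub> (cs @ ?r) @ [three_chain (a, b), three_chain (c, d)]"
      by (rule re_pair_three_chains)
    also have "\<dots> \<simeq>\<^bsub>ty\<^esub> (cs @ [three_chain (c, d)]) @ map three_chain ((a, b) # ps2)"
      by (rule permute_chains) simp
    also have "\<dots> \<simeq>\<^bsub>ty\<^esub> (cs @ [three_chain (c, d)]) @ map three_chain qs"
      by (rule Cons.IH) (use eq ps2(1) in simp)
    finally show ?thesis
      by (simp add: q)
  qed
qed

text \<open>Both sides have the same cycle lengths, 2m+5 and 2l+5 from these two chains, so this is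
  the exchange that the cycle lengths leave open.\<close>

lemma four_chains_equiv:
  "cs @ [4 # replicate m 2, replicate (Suc (Suc l)) 2]
    \<simeq>\<^bsub>ty\<^esub> cs @ [4 # replicate l 2, replicate (Suc (Suc m)) 2]"
proof -
  have "cs @ [4 # replicate m 2, replicate (Suc (Suc l)) 2]
      \<simeq>\<^bsub>ty\<^esub> (4 # replicate m 2) # replicate (Suc (Suc l)) 2 # cs"
    by (rule permute_chains) simp
  also have "\<dots> \<simeq>\<^bsub>ty\<^esub> replicate (Suc (Suc m)) 2 # (4 # replicate l 2) # cs"
  proof (cases cs)
    case Nil
    then show ?thesis
      using four_block_sizes[of "replicate m 2" "replicate l 2"]
      by (simp add: chains_equiv_def)
  next
    case Cons
    then show ?thesis
      using four_block_sizes[of "replicate m 2" "replicate l 2 @ 1 # join_chains cs"]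
      by (simp add: chains_equiv_def)
  qed
  also have "\<dots> \<simeq>\<^bsub>ty\<^esub> cs @ [4 # replicate l 2, replicate (Suc (Suc m)) 2]"
    by (rule permute_chains) simp
  finally show ?thesis .
qed

section \<open>Cycle lengths\<close>

text \<open>A cycle as the list of its points in the order of visit. That they are distinct is
  demanded separately, for all cycles together.\<close>

definition closed_walk :: "('b \<Rightarrow> 'b) \<Rightarrow> 'b list \<Rightarrow> bool" where
  "closed_walk f w \<longleftrightarrow> w \<noteq> [] \<and> (\<forall>i<length w. f (w ! i) = w ! (Suc i mod length w))"

lemma closed_walkI:
  assumes "\<And>i. Suc i < n \<Longrightarrow> f (g i) = g (Suc i)" "f (g (n - 1)) = g 0" "0 < n"
  shows "closed_walk f (map g [0..<n])"
proof -
  have "f (g i) = g (Suc i mod n)" if "i < n" for i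
    using that assms(1)[of i] assms(2) by (cases "Suc i = n") auto
  then show ?thesis
    using assms(3) by (auto simp: closed_walk_def)
qed

lemma closed_walk_map:
  assumes "closed_walk f w" "\<And>i. i \<in> set w \<Longrightarrow> f' (h i) = h (f i)"
  shows "closed_walk f' (map h w)"
  using assms by (auto simp: closed_walk_def)

lemma orbit_closed_walk:
  assumes "closed_walk f w" "a \<in> set w"
  shows "{(f ^^ k) a | k. True} = set w"
proof -
  let ?n = "length w"
  have n: "0 < ?n"
    using assms(2) by (cases w) auto
  obtain i where i: "i < ?n" "a = w ! i"
    using assms(2) by (metis in_set_conv_nth)
  have pow: "(f ^^ k) a = w ! ((i + k) mod ?n)" for k
  proof (induction k)
    case (Suc k)
    have "(i + k) mod ?n < ?n"
      using n by simp
    with Suc assms(1) show ?case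
      by (simp add: closed_walk_def mod_Suc_eq)
  qed (simp add: i)
  show ?thesis
  proof (intro equalityI subsetI)
    fix b assume "b \<in> set w"
    then obtain j where j: "j < ?n" "b = w ! j"
      by (metis in_set_conv_nth)
    have "(f ^^ (?n - i + j)) a = b"
      using i(1) j by (simp add: pow)
    then show "b \<in> {(f ^^ k) a | k. True}"
      by blast
  qed (auto simp: pow intro!: nth_mem mod_less_divisor n)
qed

lemma distinct_map_set:
  "distinct (concat ws) \<Longrightarrow> [] \<notin> set ws \<Longrightarrow> distinct (map set ws)"
proof (induction ws)
  case (Cons w ws)
  have "set w \<noteq> set v" if "v \<in> set ws" for v
  proof
    assume "set w = set v"
    moreover obtain x where "x \<in> set w"
      using Cons.prems(2) by (cases w) auto
    ultimately show False
      using Cons.prems(1) that by auto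
  qed
  with Cons show ?case by auto
qed simp

text \<open>\<open>Y_cycles\<close> is a set of orbits. Disjoint nonempty walks have different sets
  of points, so cycles of equal length are counted as often as they occur.\<close>

lemma P_inv_closed_walks:
  assumes "distinct (concat ws)" "set (concat ws) = UNIV - {inv (fst p) 1}"
    and "\<And>w. w \<in> set ws \<Longrightarrow> closed_walk (Y_map p) w"
  shows "P_inv p = mset (map length ws)"
proof -
  have ne: "[] \<notin> set ws"
    using assms(3) by (auto simp: closed_walk_def)
  have "Y_cycles p = (\<Union>w\<in>set ws. (\<lambda>a. {(Y_map p ^^ k) a | k. True}) ` set w)"
    unfolding Y_cycles_def by (subst assms(2)[symmetric]) auto
  also have "\<dots> = (\<Union>w\<in>set ws. (\<lambda>a. set w) ` set w)"
    using orbit_closed_walk[OF assms(3)] by (intro SUP_cong image_cong refl) blast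
  also have "\<dots> = set (map set ws)"
    using ne by (auto simp: image_constant_conv)
  finally have "mset_set (Y_cycles p) = mset (map set ws)"
    using mset_set_set[OF distinct_map_set[OF assms(1) ne]] by simp
  then have "P_inv p = mset (map (\<lambda>w. card (set w)) ws)"
    by (simp add: P_inv_def comp_def image_mset.compositionality)
  also have "map (\<lambda>w. card (set w)) ws = map length ws"
    using assms(1) by (auto intro: distinct_card simp: distinct_concat_iff)
  finally show ?thesis .
qed

text \<open>In terms of positions in the first row, \<^const>\<open>Y_map\<close> sends \<open>i\<close> to \<open>i + 2\<close> unless \<open>i\<close> ends a block,
  in which case \<open>i\<close> is sent to the position after the start of the preceding block. Here the first and the
  last letter count as \<open>1\<close>-blocks, \<open>s\<close> is the start of the first listed block, and \<open>r\<close> is the image of its end.\<close>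

fun acts_on_blocks :: "(nat \<Rightarrow> nat) \<Rightarrow> nat \<Rightarrow> nat \<Rightarrow> nat list \<Rightarrow> bool" where
  "acts_on_blocks y r s [] = True"
| "acts_on_blocks y r s (k # ks) \<longleftrightarrow>
     (\<forall>i. s \<le> i \<and> i + 1 < s + k \<longrightarrow> y i = i + 2) \<and> y (s + k - 1) = r \<and>
     acts_on_blocks y (s + 1) (s + k) ks"

text \<open>Behind a \<open>1\<close>-block the parameters \<open>r\<close> and \<open>s\<close>
  agree again. A chain together with the \<open>1\<close>-block closing it is thus mapped to itself,
  and the cycles can be found chain by chain.\<close>

lemma acts_on_blocks_append_1:
  "acts_on_blocks y r s (ks @ 1 # ls) \<longleftrightarrow>
    acts_on_blocks y r s (ks @ [1]) \<and>
    acts_on_blocks y (s + sum_list ks + 1) (s + sum_list ks + 1) ls"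
  by (induction ks arbitrary: r s) (auto simp: add.assoc)

text \<open>In a run of \<open>2\<close>-blocks the map climbs by two along the first letters of the
  blocks and descends by two along the second ones.\<close>

lemma acts_on_blocks_twos:
  assumes "acts_on_blocks y r s (replicate m 2 @ ks)"
  shows "t < m \<Longrightarrow> y (s + 2 * t) = s + 2 * t + 2"
    and "t < m \<Longrightarrow> y (s + 2 * t + 1) = (if t = 0 then r else s + 2 * t - 1)"
    and "acts_on_blocks y (if m = 0 then r else s + 2 * m - 1) (s + 2 * m) ks"
proof -
  have "(\<forall>t<m. y (s + 2 * t) = s + 2 * t + 2 \<and> y (s + 2 * t + 1) = (if t = 0 then r else s + 2 * t - 1)) \<and>
    acts_on_blocks y (if m = 0 then r else s + 2 * m - 1) (s + 2 * m) ks"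
    using assms
  proof (induction m arbitrary: r s)
    case (Suc m)
    then have y: "y s = s + 2" "y (s + 1) = r" and a: "acts_on_blocks y (s + 1) (s + 2) (replicate m 2 @ ks)"
      by auto
    have "y (s + 2 * t) = s + 2 * t + 2 \<and> y (s + 2 * t + 1) = (if t = 0 then r else s + 2 * t - 1)"
      if "t < Suc m" for t
    proof (cases t)
      case 0
      with y show ?thesis by simp
    next
      case (Suc t')
      then show ?thesis
        using Suc.IH[OF a] that by (auto split: if_splits)
    qed
    with Suc.IH[OF a] show ?case
      by (auto split: if_splits)
  qed simp
  then show "t < m \<Longrightarrow> y (s + 2 * t) = s + 2 * t + 2"
    "t < m \<Longrightarrow> y (s + 2 * t + 1) = (if t = 0 then r else s + 2 * t - 1)"
    "acts_on_blocks y (if m = 0 then r else s + 2 * m - 1) (s + 2 * m) ks"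
    by blast+
qed

lemma mem_map_upt: "x = f i \<Longrightarrow> i < n \<Longrightarrow> x \<in> set (map f [0..<n])"
  by auto

section \<open>Cycles contributed by a single chain\<close>

definition partition_walks :: "(nat \<Rightarrow> nat) \<Rightarrow> nat set \<Rightarrow> nat multiset \<Rightarrow> bool" where
  "partition_walks y A M \<longleftrightarrow> (\<exists>ws. distinct (concat ws) \<and> set (concat ws) = A \<and>
     (\<forall>w\<in>set ws. closed_walk y w) \<and> mset (map length ws) = M)"

lemma partition_walks_Un:
  assumes "partition_walks y A M" "partition_walks y B N" "A \<inter> B = {}"
  shows "partition_walks y (A \<union> B) (M + N)"
proof -
  obtain ws vs where "distinct (concat ws)" "set (concat ws) = A" "\<forall>w\<in>set ws. closed_walk y w"
    "mset (map length ws) = M" "distinct (concat vs)" "set (concat vs) = B"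
    "\<forall>w\<in>set vs. closed_walk y w" "mset (map length vs) = N"
    using assms(1,2) by (auto simp: partition_walks_def)
  with assms(3) show ?thesis
    unfolding partition_walks_def by (intro exI[of _ "ws @ vs"]) (auto simp del: set_concat)
qed

text \<open>Distinctness is a matter of counting: the walks have as many entries as the interval
  that they cover.\<close>

lemma partition_walksI:
  assumes "\<forall>w\<in>set ws. closed_walk y w" "set (concat ws) = {s..<s + sum_list (map length ws)}"
  shows "partition_walks y {s..<s + sum_list (map length ws)} (mset (map length ws))"
proof -
  have "distinct (concat ws)"
    by (rule card_distinct) (simp only: assms(2) card_atLeastLessThan length_concat diff_add_inverse)
  with assms show ?thesis
    by (auto simp: partition_walks_def)
qed

lemma partition_walks_pair:
  assumes "closed_walk y w" "closed_walk y v" "set w \<union> set v = {s..<s + (length w + length v)}"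
  shows "partition_walks y {s..<s + (length w + length v)} {#length w, length v#}"
  using partition_walksI[of "[w, v]" y s] assms by simp

text \<open>The appended \<open>1\<close> is the \<open>1\<close>-block that closes the chain, or
  the last letter of the pair in case of the last chain. Quantifying over \<open>y\<close> and
  \<open>s\<close> lets the statement be applied wherever the chain is located.\<close>

definition chain_cycles :: "nat list \<Rightarrow> nat multiset \<Rightarrow> bool" where
  "chain_cycles c M \<longleftrightarrow> (\<forall>y s. acts_on_blocks y s s (c @ [1]) \<longrightarrow>
     partition_walks y {s..<s + sum_list c + 1} M)"

lemma chain_cycles_twos: "chain_cycles (replicate m 2) {#2 * m + 1#}"
  unfolding chain_cycles_def
proof (intro allI impI)
  fix y s assume a: "acts_on_blocks y s s (replicate m 2 @ [1])"
  note y = acts_on_blocks_twos[OF a]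
  have x: "y (s + 2 * m) = (if m = 0 then s else s + 2 * m - 1)"
    using y(3) by simp
  \<comment> \<open>Up along the even offsets to the closing \<open>1\<close>-block at
    \<open>s + 2 * m\<close>, then down along the odd ones to \<open>s + 1\<close> and back to
    \<open>s\<close>.\<close>
  define f where "f i = (if i \<le> m then s + 2 * i else s + 2 * (2 * m + 1 - i) - 1)" for i
  have "closed_walk y (map f [0..<2 * m + 1])"
  proof (rule closed_walkI)
    fix i assume i: "Suc i < 2 * m + 1"
    consider "i < m" | "i = m" | "m < i" by linarith
    then show "y (f i) = f (Suc i)"
    proof cases
      case 3
      then have "f i = s + 2 * (2 * m - i) + 1"
        using i by (auto simp: f_def)
      with 3 i show ?thesis
        using y(2)[of "2 * m - i"] by (auto simp: f_def)
    qed (use i y(1)[of i] x in \<open>auto simp: f_def\<close>)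
  next
    show "y (f (2 * m + 1 - 1)) = f 0"
      using x y(2)[of 0] by (cases m) (auto simp: f_def)
  qed simp
  moreover have "set (map f [0..<2 * m + 1]) = {s..<s + (2 * m + 1)}"
  proof (intro equalityI subsetI)
    fix j assume j: "j \<in> {s..<s + (2 * m + 1)}"
    show "j \<in> set (map f [0..<2 * m + 1])"
    proof (cases "even (j - s)")
      case True
      then obtain t where "j - s = 2 * t" by (elim evenE)
      then show ?thesis
        using j by (intro mem_map_upt[of _ f t]) (auto simp: f_def)
    next
      case False
      then obtain t where "j - s = 2 * t + 1" by (elim oddE)
      then show ?thesis
        using j by (intro mem_map_upt[of _ f "2 * m - t"]) (auto simp: f_def)
    qed
  qed (auto simp: f_def)
  ultimately show "partition_walks y {s..<s + sum_list (replicate m 2) + 1} {#2 * m + 1#}"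
    using partition_walksI[of "[map f [0..<2 * m + 1]]" y s] by (simp add: sum_list_replicate mult.commute)
qed

text \<open>The \<open>3\<close>-block separates its sides: the walk \<open>f\<close> through the
  left \<open>2\<close>-blocks turns back at its third letter, the walk \<open>g\<close> through the
  right ones at its middle letter. Each side gives one cycle of even length.\<close>

lemma chain_cycles_three: "chain_cycles (three_chain (m, l)) {#2 * m + 2, 2 * l + 2#}"
  unfolding chain_cycles_def
proof (intro allI impI)
  fix y s assume "acts_on_blocks y s s (three_chain (m, l) @ [1])"
  then have a: "acts_on_blocks y s s (replicate m 2 @ 3 # replicate l 2 @ [1])"
    by simp
  note y = acts_on_blocks_twos[OF a]
  let ?s = "s + 2 * m"
  have y3: "y ?s = ?s + 2" "y (?s + 1) = ?s + 3" "y (?s + 2) = (if m = 0 then s else s + 2 * m - 1)"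
    and a': "acts_on_blocks y (?s + 1) (?s + 3) (replicate l 2 @ [1])"
    using y(3) by (auto simp: algebra_simps)
  note y' = acts_on_blocks_twos[OF a']
  have x: "y (?s + 3 + 2 * l) = (if l = 0 then ?s + 1 else ?s + 3 + 2 * l - 1)"
    using y'(3) by (simp add: algebra_simps)
  define f where "f i = (if i \<le> m + 1 then s + 2 * i else s + 2 * (2 * m + 2 - i) - 1)" for i
  define g where "g i = (if i \<le> l + 1 then ?s + 1 + 2 * i else ?s + 2 + 2 * (2 * l + 2 - i))" for i
  have "closed_walk y (map f [0..<2 * m + 2])"
  proof (rule closed_walkI)
    fix i assume i: "Suc i < 2 * m + 2"
    consider "i < m" | "i = m" | "i = m + 1" | "m + 1 < i" by linarith
    then show "y (f i) = f (Suc i)"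
    proof cases
      case 4
      then have "f i = s + 2 * (2 * m + 1 - i) + 1"
        using i by (auto simp: f_def)
      with 4 i show ?thesis
        using y(2)[of "2 * m + 1 - i"] by (auto simp: f_def)
    qed (use i y(1)[of i] y3 in \<open>auto simp: f_def\<close>)
  next
    show "y (f (2 * m + 2 - 1)) = f 0"
      using y3 y(2)[of 0] by (cases m) (auto simp: f_def)
  qed simp
  moreover have "closed_walk y (map g [0..<2 * l + 2])"
  proof (rule closed_walkI)
    fix i assume i: "Suc i < 2 * l + 2"
    consider "i = 0" | "0 < i" "i < l + 1" | "i = l + 1" | "l + 1 < i" by linarith
    then show "y (g i) = g (Suc i)"
    proof cases
      case 2
      then obtain i' where i': "i = Suc i'" "i' < l"
        by (cases i) auto
      then have "g i = ?s + 3 + 2 * i'" "g (Suc i) = ?s + 3 + 2 * i' + 2"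
        by (auto simp: g_def)
      then show ?thesis
        using y'(1)[OF i'(2)] by simp
    next
      case 3
      then have "g i = ?s + 3 + 2 * l" "g (Suc i) = (if l = 0 then ?s + 1 else ?s + 3 + 2 * l - 1)"
        using i by (auto simp: g_def)
      then show ?thesis
        using x by simp
    next
      case 4
      then have "g i = ?s + 3 + 2 * (2 * l + 1 - i) + 1"
        using i by (auto simp: g_def)
      moreover have "g (Suc i) = ?s + 3 + 2 * (2 * l + 1 - i) - 1" "2 * l + 1 - i \<noteq> 0" "2 * l + 1 - i < l"
        using 4 i by (auto simp: g_def)
      ultimately show ?thesis
        using y'(2)[of "2 * l + 1 - i"] by simp
    qed (use i y3 x in \<open>auto simp: g_def\<close>)
  next
    show "y (g (2 * l + 2 - 1)) = g 0"
    proof (cases "l = 0")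
      case True
      then have "g (2 * l + 2 - 1) = ?s + 3 + 2 * l" "g 0 = ?s + 1"
        by (auto simp: g_def)
      then show ?thesis
        using x True by simp
    next
      case False
      then have "g (2 * l + 2 - 1) = ?s + 3 + 2 * 0 + 1" "g 0 = ?s + 1"
        by (auto simp: g_def)
      then show ?thesis
        using y'(2)[of 0] False by simp
    qed
  qed simp
  moreover have "set (map f [0..<2 * m + 2]) \<union> set (map g [0..<2 * l + 2])
      = {s..<s + (2 * m + 2 + (2 * l + 2))}"
  proof (intro equalityI subsetI)
    fix j assume j: "j \<in> {s..<s + (2 * m + 2 + (2 * l + 2))}"
    consider t where "j = s + 2 * t" "t \<le> m + 1" | t where "j = s + 2 * t + 1" "t < m"
      | t where "j = ?s + 1 + 2 * t" "t \<le> l + 1" | t where "j = ?s + 4 + 2 * t" "t < l"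
    proof -
      show thesis
      proof (cases "even (j - s)")
        case True
        then obtain t where "j - s = 2 * t" by (elim evenE)
        then have "j = s + 2 * t"
          using j by auto
        with j show thesis
          using that(1)[of t] that(4)[of "t - m - 2"] by (cases "t \<le> m + 1") auto
      next
        case False
        then obtain t where "j - s = 2 * t + 1" by (elim oddE)
        then have "j = s + 2 * t + 1"
          using j by auto
        with j show thesis
          using that(2)[of t] that(3)[of "t - m"] by (cases "t < m") auto
      qed
    qed
    then have "(\<exists>i<2 * m + 2. j = f i) \<or> (\<exists>i<2 * l + 2. j = g i)"
    proof cases
      case (1 t)
      then show ?thesis by (intro disjI1 exI[of _ t]) (auto simp: f_def)
    next
      case (2 t)
      then show ?thesis by (intro disjI1 exI[of _ "2 * m + 1 - t"]) (auto simp: f_def)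
    next
      case (3 t)
      then show ?thesis by (intro disjI2 exI[of _ t]) (auto simp: g_def)
    next
      case (4 t)
      then show ?thesis by (intro disjI2 exI[of _ "2 * l + 1 - t"]) (auto simp: g_def)
    qed
    then show "j \<in> set (map f [0..<2 * m + 2]) \<union> set (map g [0..<2 * l + 2])"
      using mem_map_upt[of j f _ "2 * m + 2"] mem_map_upt[of j g _ "2 * l + 2"] by blast
  qed (auto simp: f_def g_def)
  moreover have "s + sum_list (three_chain (m, l)) + 1 = s + (2 * m + 2 + (2 * l + 2))"
    by (simp add: sum_list_replicate)
  ultimately show "partition_walks y {s..<s + sum_list (three_chain (m, l)) + 1} {#2 * m + 2, 2 * l + 2#}"
    using partition_walks_pair[of y "map f [0..<2 * m + 2]" "map g [0..<2 * l + 2]" s]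
    by (simp only: length_map length_upt diff_zero)
qed

text \<open>A single cycle: from \<open>s\<close> along even offsets through the whole chain, down
  the second letters of the \<open>2\<close>-blocks to \<open>s + 5\<close>, then
  \<open>s + 1\<close>, \<open>s + 3\<close> and back to \<open>s\<close>.\<close>

lemma chain_cycles_four: "chain_cycles (4 # replicate m 2) {#2 * m + 5#}"
  unfolding chain_cycles_def
proof (intro allI impI)
  fix y s assume "acts_on_blocks y s s ((4 # replicate m 2) @ [1])"
  then have "\<forall>i. s \<le> i \<and> i + 1 < s + 4 \<longrightarrow> y i = i + 2" "y (s + 3) = s"
    and a: "acts_on_blocks y (s + 1) (s + 4) (replicate m 2 @ [1])"
    by (auto simp: add.commute)
  then have y4: "y s = s + 2" "y (s + 1) = s + 3" "y (s + 2) = s + 4" "y (s + 3) = s"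
    by auto
  note y = acts_on_blocks_twos[OF a]
  have x: "y (s + 4 + 2 * m) = (if m = 0 then s + 1 else s + 4 + 2 * m - 1)"
    using y(3) by (simp add: algebra_simps)
  define f where "f i = (if i \<le> m + 2 then s + 2 * i else if i \<le> 2 * m + 2 then s + 2 * (2 * m + 3 - i) + 3
    else if i = 2 * m + 3 then s + 1 else s + 3)" for i
  have "closed_walk y (map f [0..<2 * m + 5])"
  proof (rule closed_walkI)
    fix i assume i: "Suc i < 2 * m + 5"
    consider "i = 0" | "i = 1" | "1 < i" "i < m + 2" | "i = m + 2" | "m + 2 < i" "i \<le> 2 * m + 2" | "i = 2 * m + 3"
      using i by linarith
    then show "y (f i) = f (Suc i)"
    proof cases
      case 3
      define i' where "i' = i - 2"
      with 3 have i': "i = i' + 2" "i' < m"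
        by auto
      then have "f i = s + 4 + 2 * i'" "f (Suc i) = s + 4 + 2 * i' + 2"
        by (auto simp: f_def)
      then show ?thesis
        using y(1)[OF i'(2)] by simp
    next
      case 4
      then have "f i = s + 4 + 2 * m" "f (Suc i) = (if m = 0 then s + 1 else s + 4 + 2 * m - 1)"
        by (auto simp: f_def)
      then show ?thesis
        using x by simp
    next
      case 5
      then have "f i = s + 4 + 2 * (2 * m + 2 - i) + 1"
        by (auto simp: f_def)
      moreover have "f (Suc i) = (if 2 * m + 2 - i = 0 then s + 1 else s + 4 + 2 * (2 * m + 2 - i) - 1)"
        "2 * m + 2 - i < m"
        using 5 by (auto simp: f_def)
      ultimately show ?thesis
        using y(2)[of "2 * m + 2 - i"] by simp
    qed (use i y4 x in \<open>auto simp: f_def\<close>)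
  next
    show "y (f (2 * m + 5 - 1)) = f 0"
      using y4 by (auto simp: f_def)
  qed simp
  moreover have "set (map f [0..<2 * m + 5]) = {s..<s + (2 * m + 5)}"
  proof (intro equalityI subsetI)
    fix j assume j: "j \<in> {s..<s + (2 * m + 5)}"
    consider t where "j = s + 2 * t" "t \<le> m + 2" | "j = s + 1" | "j = s + 3" | t where "j = s + 2 * t + 5" "t < m"
    proof -
      show thesis
      proof (cases "even (j - s)")
        case True
        then obtain t where "j - s = 2 * t" by (elim evenE)
        then have "j = s + 2 * t"
          using j by auto
        with j show thesis
          using that(1)[of t] by auto
      next
        case False
        then obtain t where "j - s = 2 * t + 1" by (elim oddE)
        then have "j = s + 2 * t + 1"
          using j by auto
        consider "t = 0" | "t = 1" | "2 \<le> t" by linarith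
        then show thesis
        proof cases
          case 3
          then show thesis
            using j \<open>j = s + 2 * t + 1\<close> by (intro that(4)[of "t - 2"]) auto
        qed (use that(2,3) \<open>j = s + 2 * t + 1\<close> in auto)
      qed
    qed
    then have "\<exists>i<2 * m + 5. j = f i"
    proof cases
      case (1 t)
      then show ?thesis by (intro exI[of _ t]) (auto simp: f_def)
    next
      case 2
      then show ?thesis by (intro exI[of _ "2 * m + 3"]) (auto simp: f_def)
    next
      case 3
      then show ?thesis by (intro exI[of _ "2 * m + 4"]) (auto simp: f_def)
    next
      case (4 t)
      then show ?thesis by (intro exI[of _ "2 * m + 2 - t"]) (auto simp: f_def)
    qed
    then show "j \<in> set (map f [0..<2 * m + 5])"
      using mem_map_upt[of j f _ "2 * m + 5"] by blast
  qed (auto simp: f_def)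
  ultimately show "partition_walks y {s..<s + sum_list (4 # replicate m 2) + 1} {#2 * m + 5#}"
    using partition_walksI[of "[map f [0..<2 * m + 5]]" y s] by (simp add: sum_list_replicate algebra_simps)
qed

text \<open>On a chain with one \<open>k\<close>-block the map is the rotation by 2 of k+1
  positions, the last being the closing \<open>1\<close>-block: one cycle if k+1 is odd, two of half
  the length if it is even.\<close>

definition single_cycles :: "nat \<Rightarrow> nat multiset" where
  "single_cycles k = (if even k then {#k + 1#} else {#(k + 1) div 2, (k + 1) div 2#})"

lemma chain_cycles_single:
  assumes "0 < k"
  shows "chain_cycles [k] (single_cycles k)"
  unfolding chain_cycles_def
proof (intro allI impI)
  fix y s assume "acts_on_blocks y s s ([k] @ [1])"
  then have y: "s \<le> i \<Longrightarrow> i + 1 < s + k \<Longrightarrow> y i = i + 2" "y (s + k - 1) = s" "y (s + k) = s + 1" for i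
    by auto
  show "partition_walks y {s..<s + sum_list [k] + 1} (single_cycles k)"
  proof (cases "even k")
    case True
    then obtain j where k: "k = 2 * j" by (elim evenE)
    define f where "f i = (if i \<le> j then s + 2 * i else s + 2 * (i - j) - 1)" for i
    have "closed_walk y (map f [0..<k + 1])"
    proof (rule closed_walkI)
      fix i assume i: "Suc i < k + 1"
      consider "i < j" | "i = j" | "j < i" by linarith
      then show "y (f i) = f (Suc i)"
        by cases (use i k y(1)[of "f i"] y(3) in \<open>auto simp: f_def\<close>)
    next
      show "y (f (k + 1 - 1)) = f 0"
        using y(2) assms by (auto simp: f_def k)
    qed simp
    moreover have "set (map f [0..<k + 1]) = {s..<s + (k + 1)}"
    proof (intro equalityI subsetI)
      fix i assume i: "i \<in> {s..<s + (k + 1)}"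
      show "i \<in> set (map f [0..<k + 1])"
      proof (cases "even (i - s)")
        case True
        then obtain t where "i - s = 2 * t" by (elim evenE)
        then show ?thesis
          using i k by (intro mem_map_upt[of _ f t]) (auto simp: f_def)
      next
        case False
        then obtain t where "i - s = 2 * t + 1" by (elim oddE)
        then show ?thesis
          using i k by (intro mem_map_upt[of _ f "j + 1 + t"]) (auto simp: f_def)
      qed
    qed (auto simp: f_def k)
    ultimately show ?thesis
      using partition_walksI[of "[map f [0..<k + 1]]" y s] True by (simp add: single_cycles_def)
  next
    case False
    then obtain j where k: "k = 2 * j + 1" by (elim oddE)
    let ?f = "\<lambda>i. s + 2 * i" and ?g = "\<lambda>i. s + 1 + 2 * i"
    have "closed_walk y (map ?f [0..<j + 1])" "closed_walk y (map ?g [0..<j + 1])"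
      by (rule closed_walkI; use y k in force)+
    moreover have "set (map ?f [0..<j + 1]) \<union> set (map ?g [0..<j + 1]) = {s..<s + (j + 1 + (j + 1))}"
    proof (intro equalityI subsetI)
      fix i assume i: "i \<in> {s..<s + (j + 1 + (j + 1))}"
      have "i = ?f ((i - s) div 2) \<or> i = ?g ((i - s) div 2)" "(i - s) div 2 < j + 1"
        using i by auto
      then show "i \<in> set (map ?f [0..<j + 1]) \<union> set (map ?g [0..<j + 1])"
        using mem_map_upt[of i ?f _ "j + 1"] mem_map_upt[of i ?g _ "j + 1"] by blast
    qed auto
    ultimately show ?thesis
      using partition_walks_pair[of y "map ?f [0..<j + 1]" "map ?g [0..<j + 1]" s] False
      by (simp add: single_cycles_def k mult_2 del: upt_Suc)
  qed
qed

lemma partition_walks_join_chains: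
  assumes "list_all2 chain_cycles cs Ms" "cs \<noteq> []" "acts_on_blocks y s s (join_chains cs @ [1])"
  shows "partition_walks y {s..<s + sum_list (join_chains cs) + 1} (sum_list Ms)"
  using assms
proof (induction cs Ms arbitrary: s rule: list_all2_induct)
  case (Cons c cs M Ms)
  show ?case
  proof (cases "cs = []")
    case True
    then have "Ms = []"
      using Cons.hyps(2) by simp
    with Cons True show ?thesis
      by (simp add: chain_cycles_def)
  next
    case False
    let ?s = "s + sum_list c + 1"
    have "acts_on_blocks y s s (c @ 1 # (join_chains cs @ [1]))"
      using Cons.prems False by (simp add: join_chains_Cons)
    then have a: "acts_on_blocks y s s (c @ [1])" "acts_on_blocks y ?s ?s (join_chains cs @ [1])"
      unfolding acts_on_blocks_append_1[of y s s c "join_chains cs @ [1]"] by blast+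
    have "partition_walks y ({s..<?s} \<union> {?s..<?s + sum_list (join_chains cs) + 1}) (M + sum_list Ms)"
      using a Cons.hyps(1) Cons.IH[OF False a(2)]
      by (intro partition_walks_Un) (auto simp: chain_cycles_def)
    moreover have "{s..<?s} \<union> {?s..<?s + sum_list (join_chains cs) + 1}
        = {s..<s + sum_list (join_chains (c # cs)) + 1}"
      using False by (auto simp: join_chains_Cons)
    ultimately show ?thesis
      by simp
  qed
qed simp

lemma block_sizes_simps [simp]:
  "block_sizes [a] = []" "block_sizes (a # b # ks) = (b - a) # block_sizes (b # ks)"
  by (simp_all add: block_sizes_def)

lemma sum_block_sizes:
  "sorted_wrt (<) ks \<Longrightarrow> ks \<noteq> [] \<Longrightarrow> hd ks + sum_list (block_sizes ks) = last ks"
proof (induction ks rule: induct_list012)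
  case (3 a b ks)
  then show ?case by auto
qed auto

section \<open>The map \<open>Y_map\<close> and the words of a piece-wise order reversing
  pair\<close>

locale reversing_pair =
  fixes p :: "'a::finite ipair" and ks :: "nat list"
  assumes pair: "is_pair p" and decomp: "pwor_decomp p ks" and card: "2 \<le> CARD('a)"
begin

definition top :: "nat \<Rightarrow> 'a" where "top = inv (fst p)"
definition bot :: "nat \<Rightarrow> 'a" where "bot = inv (snd p)"

lemma fst_range: "fst p x \<in> {1..CARD('a)}" and snd_range: "snd p x \<in> {1..CARD('a)}"
  using pair by (auto simp: is_pair_def bij_betw_def)

lemma fst_top: "i \<in> {1..CARD('a)} \<Longrightarrow> fst p (top i) = i"
  using pair by (metis bij_betw_def f_inv_into_f is_pair_def top_def)

lemma snd_bot: "i \<in> {1..CARD('a)} \<Longrightarrow> snd p (bot i) = i"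
  using pair by (metis bij_betw_def f_inv_into_f is_pair_def bot_def)

lemma top_fst [simp]: "top (fst p x) = x"
  using pair by (auto simp: top_def is_pair_def bij_betw_def intro: inv_f_f)

lemma bot_snd [simp]: "bot (snd p x) = x"
  using pair by (auto simp: bot_def is_pair_def bij_betw_def intro: inv_f_f)

lemma top_eq_iff: "i \<in> {1..CARD('a)} \<Longrightarrow> j \<in> {1..CARD('a)} \<Longrightarrow> top i = top j \<longleftrightarrow> i = j"
  by (metis fst_top)

lemma standard: "bot (CARD('a)) = top 1" "bot 1 = top (CARD('a))"
  using decomp by (auto simp: pwor_decomp_def standard_pair_def top_def bot_def)

lemma ks: "ks \<noteq> []" "hd ks = 2" "last ks = CARD('a)" "sorted_wrt (<) ks"
  using decomp by (auto simp: pwor_decomp_def)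

lemma ks_bounds: "a \<in> set ks \<Longrightarrow> 2 \<le> a \<and> a \<le> CARD('a)"
proof -
  have "sorted ks"
    using ks(4) by (simp add: strict_sorted_iff)
  assume "a \<in> set ks"
  then obtain i where i: "i < length ks" "a = ks ! i"
    by (metis in_set_conv_nth)
  have "ks ! 0 \<le> ks ! i" "ks ! i \<le> ks ! (length ks - 1)"
    using i(1) \<open>sorted ks\<close> by (auto intro: sorted_nth_mono)
  with i ks(1-3) show ?thesis
    by (simp add: hd_conv_nth last_conv_nth)
qed

lemma consecutive: "ks = xs @ a # b # ys \<Longrightarrow> 2 \<le> a \<and> a < b \<and> b \<le> CARD('a)"
proof -
  assume eq: "ks = xs @ a # b # ys"
  then have "a \<in> set ks" "b \<in> set ks" "a < b"
    using ks(4) by (simp_all add: sorted_wrt_append)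
  then show ?thesis
    using ks_bounds by blast
qed

lemma block:
  assumes "ks = xs @ a # b # ys" "a \<le> i" "i < b"
  shows "snd p (top i) = a + b - 1 - i" and "bot i = top (a + b - 1 - i)"
proof -
  note ab = consecutive[OF assms(1)]
  have ix: "0 < Suc (length xs) \<and> Suc (length xs) < length ks"
    "ks ! (Suc (length xs) - 1) = a" "ks ! Suc (length xs) = b"
    by (simp_all add: assms(1) nth_append)
  have "\<forall>i. 0 < i \<and> i < length ks \<longrightarrow>
     {x. fst p x \<in> {ks ! (i - 1)..ks ! i - 1}} = {x. snd p x \<in> {ks ! (i - 1)..ks ! i - 1}} \<and>
     (\<forall>x\<in>{x. fst p x \<in> {ks ! (i - 1)..ks ! i - 1}}. fst p x + snd p x = ks ! (i - 1) + ks ! i - 1)"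
    using decomp unfolding pwor_decomp_def Let_def by blast
  from this[rule_format, OF ix(1)]
  have "{x. fst p x \<in> {a..b - 1}} = {x. snd p x \<in> {a..b - 1}}"
    and B: "\<And>x. fst p x \<in> {a..b - 1} \<Longrightarrow> fst p x + snd p x = a + b - 1"
    unfolding ix by blast+
  then have B': "fst p x \<in> {a..b - 1} \<longleftrightarrow> snd p x \<in> {a..b - 1}" for x
    by blast
  have i: "i \<in> {1..CARD('a)}" "i \<in> {a..b - 1}"
    using assms(2,3) ab by simp_all
  show "snd p (top i) = a + b - 1 - i"
    using B[of "top i"] i(2) unfolding fst_top[OF i(1)] by simp
  have "fst p (bot i) \<in> {a..b - 1}"
    unfolding B' snd_bot[OF i(1)] by (rule i(2))
  from B[OF this] have "fst p (bot i) = a + b - 1 - i"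
    unfolding snd_bot[OF i(1)] by simp
  then show "bot i = top (a + b - 1 - i)"
    using top_fst by metis
qed

text \<open>Standardness puts the last letter of each row at position 1 of the other, so the
  exceptional second case of \<open>S_map\<close> occurs at position 2 of the second row and has the
  value \<open>top 2\<close>.\<close>

lemma S_map_eq:
  "S_map p x = (if snd p x = 1 then top 1 else if snd p x = 2 then top 2
     else top (fst p (bot (snd p x - 1)) + 1))"
proof -
  have "snd p (inv (fst p) (CARD('a))) = 1"
    using snd_bot[of 1] standard(2) card by (simp add: top_def)
  moreover have "fst p (inv (snd p) (CARD('a))) = 1"
    using fst_top[of 1] standard(1) card by (simp add: bot_def)
  ultimately show ?thesis
    by (simp add: S_map_def Let_def top_def bot_def numeral_2_eq_2)
qed

lemma Y_map_eq1: "S_map p x \<noteq> top 1 \<Longrightarrow> Y_map p x = S_map p x"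
  unfolding Y_map_def Let_def top_def[symmetric]
  by (subst Least_equality[of _ 1]) auto

lemma Y_map_eq2:
  assumes "S_map p x = top 1" "S_map p (top 1) \<noteq> top 1"
  shows "Y_map p x = S_map p (top 1)"
proof -
  have "(LEAST k. 0 < k \<and> (S_map p ^^ k) x \<noteq> top 1) = 2"
  proof (rule Least_equality)
    show "0 < (2 :: nat) \<and> (S_map p ^^ 2) x \<noteq> top 1"
      using assms by (simp add: numeral_2_eq_2)
    fix k assume k: "0 < k \<and> (S_map p ^^ k) x \<noteq> top 1"
    then have "k \<noteq> 1"
      using assms(1) by auto
    with k show "2 \<le> k"
      by simp
  qed
  then show ?thesis
    using assms(1) by (simp add: Y_map_def Let_def top_def[symmetric] numeral_2_eq_2)
qed

lemma top_neq_1: "2 \<le> i \<Longrightarrow> i \<le> CARD('a) \<Longrightarrow> top i \<noteq> top 1"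
  using top_eq_iff[of i 1] by auto

text \<open>Because the block is reversed, the predecessor in the second row of the letter at
  \<open>i\<close> is the letter at \<open>i + 1\<close>, and its successor in the first row is at
  \<open>i + 2\<close>.\<close>

lemma Y_map_inner:
  assumes "ks = xs @ a # b # ys" "a \<le> i" "i + 1 < b"
  shows "Y_map p (top i) = top (i + 2)"
proof -
  note ab = consecutive[OF assms(1)]
  have "S_map p (top i) = top (i + 2)"
    using block[OF assms(1), of i] block[OF assms(1), of "a + b - 1 - i - 1"] assms(2,3) ab
      fst_top[of "i + 1"] by (auto simp: S_map_eq)
  then show ?thesis
    using Y_map_eq1 top_neq_1[of "i + 2"] assms ab by simp
qed

text \<open>Here \<open>xs\<close> lists the starts of the earlier blocks. Without any, the
  preceding block is the first letter at position 1, which gives 2.\<close>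

definition block_image :: "nat list \<Rightarrow> nat" where
  "block_image xs = (if xs = [] then 2 else last xs + 1)"

lemma block_image_bounds: "ks = xs @ a # ys \<Longrightarrow> 2 \<le> block_image xs \<and> block_image xs \<le> CARD('a)"
proof (cases xs rule: rev_cases)
  case (snoc xs' a')
  assume "ks = xs @ a # ys"
  then show ?thesis
    using snoc consecutive[of xs' a' a ys] by (auto simp: block_image_def)
qed (use card in \<open>auto simp: block_image_def\<close>)

lemma image_of_block_end:
  assumes "ks = xs @ a # ys" "snd p x = a"
  shows "S_map p x = top (block_image xs)"
proof (cases xs rule: rev_cases)
  case Nil
  then show ?thesis
    using assms ks by (auto simp: S_map_eq block_image_def)
next
  case (snoc xs' a')
  then have "ks = xs' @ a' # a # ys"
    using assms(1) by simp
  then show ?thesis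
    using block(2)[of xs' a' a ys "a - 1"] consecutive[of xs' a' a ys] fst_top[of a'] assms(2) snoc
    by (auto simp: S_map_eq block_image_def)
qed

lemma Y_map_block_end:
  assumes "ks = xs @ a # b # ys"
  shows "Y_map p (top (b - 1)) = top (block_image xs)"
proof -
  have "snd p (top (b - 1)) = a"
    using block(1)[OF assms, of "b - 1"] consecutive[OF assms] by auto
  then have "S_map p (top (b - 1)) = top (block_image xs)"
    using image_of_block_end assms by blast
  then show ?thesis
    using Y_map_eq1 top_neq_1 block_image_bounds[of xs a "b # ys"] assms by simp
qed

text \<open>The first return takes two steps here: \<open>S_map\<close> sends the last letter to the
  first one, whose position \<open>CARD('a)\<close> in the second row makes it behave like the end
  of a block starting there. This is why the last letter counts as a final
  \<open>1\<close>-block.\<close>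

lemma Y_map_last: "Y_map p (top (CARD('a))) = top (block_image (butlast ks))"
proof -
  have last: "ks = butlast ks @ CARD('a) # []"
    using ks by (metis append_butlast_last_id)
  have "snd p (top 1) = CARD('a)"
    using snd_bot[of "CARD('a)"] standard card by simp
  then have "S_map p (top 1) = top (block_image (butlast ks))"
    using image_of_block_end last by blast
  moreover have "S_map p (top (CARD('a))) = top 1"
    using snd_bot[of 1] standard card by (simp add: S_map_eq)
  ultimately show ?thesis
    using Y_map_eq2 top_neq_1 block_image_bounds[OF last] by simp
qed

definition Y_pos :: "nat \<Rightarrow> nat" where
  "Y_pos i = fst p (Y_map p (top i))"

lemma acts_on_blocks_suffix:
  "ks = xs @ a # ys \<Longrightarrow> acts_on_blocks Y_pos (block_image xs) a (block_sizes (a # ys) @ [1])"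
proof (induction ys arbitrary: xs a)
  case Nil
  then have "a = CARD('a)" "xs = butlast ks"
    using ks(3) by auto
  then show ?case
    using Y_map_last block_image_bounds[OF Nil] fst_top by (auto simp: Y_pos_def)
next
  case (Cons b ys)
  note ab = consecutive[OF Cons.prems]
  have "acts_on_blocks Y_pos (block_image (xs @ [a])) b (block_sizes (b # ys) @ [1])"
    by (rule Cons.IH) (simp add: Cons.prems)
  moreover have "Y_pos i = i + 2" if "a \<le> i" "i + 1 < b" for i
    using Y_map_inner[OF Cons.prems that] fst_top[of "i + 2"] that ab by (auto simp: Y_pos_def)
  moreover have "Y_pos (b - 1) = block_image xs"
    using Y_map_block_end[OF Cons.prems] fst_top block_image_bounds[OF Cons.prems]
    by (auto simp: Y_pos_def)
  ultimately show ?case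
    using ab by (auto simp: block_image_def)
qed

lemma acts_on_blocks_Y_pos: "acts_on_blocks Y_pos 2 2 (block_sizes ks @ [1])"
  using acts_on_blocks_suffix[of "[]" 2 "tl ks"] ks by (cases ks) (auto simp: block_image_def)

lemma sum_sizes: "sum_list (block_sizes ks) + 2 = CARD('a)"
  using sum_block_sizes[of ks] ks by simp

lemma P_inv_chains:
  assumes "list_all2 chain_cycles (chains (block_sizes ks)) Ms"
  shows "P_inv p = sum_list Ms"
proof -
  have "partition_walks Y_pos {2..<2 + sum_list (block_sizes ks) + 1} (sum_list Ms)"
    by (rule partition_walks_join_chains[OF assms chains_nonempty, of Y_pos 2,
          unfolded join_chains_chains, OF acts_on_blocks_Y_pos])
  moreover have "{2..<2 + sum_list (block_sizes ks) + 1} = {2..CARD('a)}"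
    using sum_sizes by auto
  ultimately obtain ws where ws: "distinct (concat ws)" "set (concat ws) = {2..CARD('a)}"
    "\<forall>w\<in>set ws. closed_walk Y_pos w" "mset (map length ws) = sum_list Ms"
    by (auto simp: partition_walks_def)
  have conc: "concat (map (map top) ws) = map top (concat ws)"
    by (simp add: map_concat)
  have "inj_on top {2..CARD('a)}"
    by (rule inj_onI) (use top_eq_iff in auto)
  then have "distinct (concat (map (map top) ws))"
    using ws(1,2) by (simp only: conc distinct_map simp_thms)
  moreover have "set (concat (map (map top) ws)) = UNIV - {inv (fst p) 1}"
  proof -
    have "top ` {2..CARD('a)} = UNIV - {top 1}"
    proof (intro equalityI subsetI)
      fix x assume "x \<in> UNIV - {top 1}"
      then have "fst p x \<noteq> 1"
        by (metis DiffD2 insertI1 top_fst)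
      with fst_range[of x] have "fst p x \<in> {2..CARD('a)}"
        by auto
      then show "x \<in> top ` {2..CARD('a)}"
        by (metis image_eqI top_fst)
    qed (use top_neq_1 in auto)
    moreover have "set (concat (map (map top) ws)) = top ` {2..CARD('a)}"
      by (simp only: conc set_map ws(2))
    ultimately show ?thesis
      by (simp only: top_def)
  qed
  moreover have "closed_walk (Y_map p) w" if "w \<in> set (map (map top) ws)" for w
    using that ws(3) by (auto intro!: closed_walk_map[where f = Y_pos] simp: Y_pos_def)
  ultimately have "P_inv p = mset (map length (map (map top) ws))"
    by (rule P_inv_closed_walks)
  then show ?thesis
    using ws(4) by (simp add: comp_def)
qed

lemma ex_blocks:
  "ks = xs @ a # ys \<Longrightarrow> \<exists>bs. map length bs = block_sizes (a # ys) \<and>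
     concat bs = map top [a..<CARD('a)] \<and> concat (map rev bs) = map bot [a..<CARD('a)]"
proof (induction ys arbitrary: xs a)
  case Nil
  then show ?case
    using ks(3) by (intro exI[of _ "[]"]) simp
next
  case (Cons b ys)
  note ab = consecutive[OF Cons.prems]
  obtain bs where bs: "map length bs = block_sizes (b # ys)" "concat bs = map top [b..<CARD('a)]"
    "concat (map rev bs) = map bot [b..<CARD('a)]"
    using Cons.IH[of "xs @ [a]" b] Cons.prems by auto
  have "rev (map top [a..<b]) = map bot [a..<b]"
    using block(2)[OF Cons.prems] ab
    by (intro nth_equalityI) (auto simp: rev_nth)
  moreover have "[a..<CARD('a)] = [a..<b] @ [b..<CARD('a)]"
    using ab upt_add_eq_append[of a b "CARD('a) - b"] by simp
  ultimately show ?case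
    using bs by (intro exI[of _ "map top [a..<b] # bs"]) simp
qed

lemma ex_block_words_pair:
  obtains a z bs where "map length bs = block_sizes ks" "valid (block_words a z bs)"
    "p = pair_of (block_words a z bs)"
proof -
  obtain bs where bs: "map length bs = block_sizes ks" "concat bs = map top [2..<CARD('a)]"
    "concat (map rev bs) = map bot [2..<CARD('a)]"
    using ex_blocks[of "[]" 2 "tl ks"] ks by (cases ks) auto
  have upt: "[1..<Suc (CARD('a))] = 1 # [2..<CARD('a)] @ [CARD('a)]"
    using card by (simp add: upt_conv_Cons numeral_2_eq_2)
  have words: "block_words (top 1) (top (CARD('a))) bs = (map top [1..<Suc (CARD('a))], map bot [1..<Suc (CARD('a))])"
    unfolding upt block_words_def using bs standard by simp
  have "inj_on top {1..CARD('a)}"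
    by (rule inj_onI) (use top_eq_iff in auto)
  moreover have "set (map top [1..<Suc (CARD('a))]) = UNIV"
  proof -
    have "x \<in> top ` {1..CARD('a)}" for x
      by (metis fst_range image_eqI top_fst)
    then show ?thesis
      by (auto simp: atLeastLessThanSuc_atLeastAtMost simp del: upt_Suc)
  qed
  ultimately have "valid_word (map top [1..<Suc (CARD('a))])"
    by (simp add: valid_word_def distinct_map atLeastLessThanSuc_atLeastAtMost del: upt_Suc)
  then have valid: "valid (block_words (top 1) (top (CARD('a))) bs)"
    using words by (intro valid_block_words) (simp add: block_words_def del: upt_Suc)
  have pos: "pos (map h [1..<Suc (CARD('a))]) x = g x"
    if "valid_word (map h [1..<Suc (CARD('a))])" "g x \<in> {1..CARD('a)}" "h (g x) = x"
    for h and g :: "'a \<Rightarrow> nat" and x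
    using that pos_nth[of "map h [1..<Suc (CARD('a))]" "g x - 1"]
    by (auto simp: valid_word_def simp del: upt_Suc)
  have v: "valid_word (map top [1..<Suc (CARD('a))])" "valid_word (map bot [1..<Suc (CARD('a))])"
    using valid unfolding words by simp_all
  have "p = pair_of (block_words (top 1) (top (CARD('a))) bs)"
    unfolding words pair_of_def
    using pos[of top "fst p", OF v(1) fst_range top_fst] pos[of bot "snd p", OF v(2) snd_range bot_snd]
    by (intro prod_eqI ext) (simp_all only: fst_conv snd_conv)
  with bs(1) valid show thesis
    by (rule that)
qed

lemma P_inv_mset_chains:
  assumes "mset cs = mset (chains (block_sizes ks))" "list_all2 chain_cycles cs Ms"
  shows "P_inv p = sum_list Ms"
proof -
  obtain Ns where "list_all2 chain_cycles (chains (block_sizes ks)) Ns" "mset Ns = mset Ms"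
    using list_all2_reorder_left_invariance[OF assms(2)] assms(1) by metis
  then show ?thesis
    using P_inv_chains by (metis sum_mset_sum_list)
qed

lemma block_sizes_gt_0: "k \<in> set (block_sizes ks) \<Longrightarrow> 0 < k"
proof -
  have "sorted_wrt (<) ls \<Longrightarrow> k \<in> set (block_sizes ls) \<Longrightarrow> 0 < k" for ls
  proof (induction ls rule: induct_list012)
    case 1
    then show ?case by (simp add: block_sizes_def)
  qed auto
  with ks(4) show "k \<in> set (block_sizes ks) \<Longrightarrow> 0 < k"
    by blast
qed

end

section \<open>Comparison of two pairs\<close>

lemma set_take_pos: "valid_word u \<Longrightarrow> {a. pos u a \<in> {1..k}} = set (take k u)"
proof (intro equalityI subsetI)
  fix a assume u: "valid_word u" and a: "a \<in> {a. pos u a \<in> {1..k}}"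
  then have "a \<in> set u"
    by (simp add: valid_word_def)
  then have "u ! (pos u a - 1) = a" "pos u a \<le> length u"
    by (simp_all only: nth_pos pos_le)
  with a show "a \<in> set (take k u)"
    by (auto simp: in_set_conv_nth intro!: exI[of _ "pos u a - 1"])
next
  fix a assume "valid_word u" "a \<in> set (take k u)"
  then show "a \<in> {a. pos u a \<in> {1..k}}"
    by (auto simp: in_set_conv_nth valid_word_def pos_nth)
qed

lemma irreducible_pair_of:
  assumes "valid (w :: 'a::finite list \<times> 'a list)" "irreducible_pair (pair_of w)"
  shows "good w"
proof -
  obtain u v where w: "w = (u, v)" by force
  have "valid_word u" "valid_word v"
    using assms(1) by (simp_all add: w)
  then have "irreducible_words w"
    using assms(2) unfolding irreducible_pair_def irreducible_words_def pair_of_def w fst_conv snd_conv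
    by (simp only: set_take_pos length_valid_word simp_thms)
  with assms(1) show ?thesis
    by (simp add: good_def)
qed

text \<open>The chains of either pair may be listed in any convenient order, so only the normal form
  of each type has to be compared.\<close>

lemma nonlabeled_ext_class_eqI:
  fixes p q :: "'a::finite ipair"
  assumes p: "reversing_pair p ks" and q: "reversing_pair q ls" and irr: "irreducible_pair p"
    and cs: "mset cs = mset (chains (block_sizes ks))"
    and ds: "mset ds = mset (chains (block_sizes ls))"
    and eq: "cs \<simeq>\<^bsub>TYPE('a)\<^esub> ds"
  shows "nonlabeled_ext_class p = nonlabeled_ext_class q"
proof -
  have "chains (block_sizes ks) \<simeq>\<^bsub>TYPE('a)\<^esub> cs" "ds \<simeq>\<^bsub>TYPE('a)\<^esub> chains (block_sizes ls)"
    by (rule permute_chains, simp only: cs ds)+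
  with eq have "chains (block_sizes ks) \<simeq>\<^bsub>TYPE('a)\<^esub> chains (block_sizes ls)"
    using chains_equiv_trans by blast
  then have *: "block_sizes ks \<sim>\<^bsub>TYPE('a)\<^esub> block_sizes ls"
    by (simp add: chains_equiv_def)
  obtain a z bs where w: "map length bs = block_sizes ks" "valid (block_words a z bs)"
    "p = pair_of (block_words a z bs)"
    by (rule reversing_pair.ex_block_words_pair[OF p])
  obtain a' z' bs' where w': "map length bs' = block_sizes ls" "valid (block_words a' z' bs')"
    "q = pair_of (block_words a' z' bs')"
    by (rule reversing_pair.ex_block_words_pair[OF q])
  have "block_words a z bs \<approx> block_words a' z' bs'"
    using * w(1,2) w'(1,2) unfolding sizes_equiv_def by blast
  moreover have "good (block_words a z bs)"
    using irreducible_pair_of[OF w(2)] irr unfolding w(3) by blast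
  ultimately show ?thesis
    unfolding w(3) w'(3) using reversing_pair.card[OF p] by (rule nonlabeled_ext_class_equiv)
qed

section \<open>Normal forms of the chains\<close>

abbreviation twos :: "nat \<Rightarrow> nat list" where
  "twos n \<equiv> replicate n 2"

lemma list_all2_twos: "list_all2 chain_cycles (map twos ns) (map (\<lambda>n. {#2 * n + 1#}) ns)"
  by (auto simp: list_all2_conv_all_nth intro: chain_cycles_twos[simplified])

lemma sum_list_twos: "sum_list (map (\<lambda>n. {#2 * n + 1#}) ns) = mset (map (\<lambda>n. 2 * n + 1) ns)"
  by (induction ns) auto

lemma list_all2_three_chains:
  "list_all2 chain_cycles (map three_chain ps) (map (\<lambda>(m, l). {#2 * m + 2, 2 * l + 2#}) ps)"
  using chain_cycles_three by (auto simp: list_all2_conv_all_nth simp del: three_chain.simps split: prod.split)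

lemma sum_list_three_chains:
  "sum_list (map (\<lambda>(m, l). {#2 * m + 2, 2 * l + 2#}) ps) = image_mset (\<lambda>n. 2 * n + 2) (flat ps)"
  by (induction ps) auto

lemma mset_eq_mset_map_iff: "inj f \<Longrightarrow> image_mset f M = image_mset f N \<longleftrightarrow> M = N"
  by (metis injD multiset.inj_map)

lemma ex_twos:
  assumes "\<forall>c\<in>set cs. \<forall>x\<in>set c. x = 2"
  shows "cs = map twos (map length cs)"
  using assms by (induction cs) (auto simp: replicate_length_same)

lemma ex_three_chains:
  assumes "\<forall>c\<in>set cs. (\<exists>n. c = twos n) \<or> (\<exists>x. c = three_chain x)"
  shows "\<exists>ns ps. mset (map twos ns @ map three_chain ps) = mset cs"
  using assms
proof (induction cs)
  case (Cons c cs)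
  then obtain ns ps where IH: "mset (map twos ns @ map three_chain ps) = mset cs"
    by auto
  from Cons.prems consider n where "c = twos n" | x where "c = three_chain x"
    by auto
  then show ?case
  proof cases
    case (1 n)
    with IH show ?thesis
      by (intro exI[of _ "n # ns"] exI[of _ ps]) simp
  next
    case (2 x)
    with IH show ?thesis
      by (intro exI[of _ ns] exI[of _ "x # ps"]) simp
  qed
qed auto

lemma ex_remove_nth:
  assumes "i < length cs" "\<forall>j<length cs. j \<noteq> i \<longrightarrow> Q (cs ! j)"
  shows "\<exists>ds. mset (ds @ [cs ! i]) = mset cs \<and> (\<forall>c\<in>set ds. Q c)"
proof (intro exI conjI ballI)
  show "mset ((take i cs @ drop (Suc i) cs) @ [cs ! i]) = mset cs"
    using arg_cong[OF id_take_nth_drop[OF assms(1)], of mset] by simp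
  fix c assume "c \<in> set (take i cs @ drop (Suc i) cs)"
  then have "c \<in> set (take i cs) \<or> c \<in> set (drop (Suc i) cs)"
    by simp
  then show "Q c"
  proof
    assume "c \<in> set (take i cs)"
    then obtain j where "j < i" "c = cs ! j"
      by (auto simp: in_set_conv_nth)
    then show "Q c"
      using assms by simp
  next
    assume "c \<in> set (drop (Suc i) cs)"
    then obtain j where "j < length cs - Suc i" "c = cs ! (Suc i + j)"
      by (auto simp: in_set_conv_nth)
    then show "Q c"
      using assms(2)[rule_format, of "Suc i + j"] by simp
  qed
qed

lemma chains_elem: "c \<in> set (chains ns) \<Longrightarrow> k \<in> set c \<Longrightarrow> k \<in> set ns \<and> k \<noteq> 1"
proof (induction ns arbitrary: c)
  case (Cons n ns)
  obtain d ds where "chains ns = d # ds"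
    by (meson chains_nonempty neq_Nil_conv)
  with Cons.prems Cons.IH[of c] Cons.IH[of d] show ?case
    by (auto simp: Let_def split: if_splits)
qed simp

lemma sum_list_join_chains:
  "cs \<noteq> [] \<Longrightarrow> sum_list (join_chains cs) + 1 = sum_list (map sum_list cs) + length cs"
  by (induction cs rule: join_chains.induct) auto

section \<open>Two pairs with equal cycle lengths, by type\<close>

context
  fixes p q :: "'a::finite ipair" and ks ls :: "nat list"
  assumes p: "reversing_pair p ks" and q: "reversing_pair q ls"
    and irr: "irreducible_pair p" and P: "P_inv p = P_inv q"
begin

text \<open>Serves types 2 and 3 together. The odd cycle lengths determine \<open>mset ns\<close>,
  where 0 stands for an empty chain, and the even ones determine \<open>flat ps\<close>; the pairing
  inside \<open>ps\<close> is adjusted by \<open>three_chains_equiv\<close>.\<close>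

lemma same_class_twos_three_chains:
  assumes cs: "mset (map twos ns @ map three_chain ps) = mset (chains (block_sizes ks))"
    and ds: "mset (map twos ns' @ map three_chain ps') = mset (chains (block_sizes ls))"
  shows "nonlabeled_ext_class p = nonlabeled_ext_class q"
proof -
  let ?o = "\<lambda>n :: nat. 2 * n + 1" and ?e = "\<lambda>n :: nat. 2 * n + 2"
  have P_eq: "P_inv p = image_mset ?o (mset ns) + image_mset ?e (flat ps)"
    using reversing_pair.P_inv_mset_chains[OF p cs list_all2_appendI[OF list_all2_twos list_all2_three_chains]]
    by (simp only: sum_list_append sum_list_twos sum_list_three_chains mset_map)
  have Q_eq: "P_inv q = image_mset ?o (mset ns') + image_mset ?e (flat ps')"
    using reversing_pair.P_inv_mset_chains[OF q ds list_all2_appendI[OF list_all2_twos list_all2_three_chains]]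
    by (simp only: sum_list_append sum_list_twos sum_list_three_chains mset_map)
  have "filter_mset odd (P_inv p) = image_mset ?o (mset ns)" "filter_mset even (P_inv p) = image_mset ?e (flat ps)"
    "filter_mset odd (P_inv q) = image_mset ?o (mset ns')" "filter_mset even (P_inv q) = image_mset ?e (flat ps')"
    unfolding P_eq Q_eq by (simp_all add: filter_mset_image_mset)
  moreover have "inj ?o" "inj ?e"
    by (auto intro: injI)
  ultimately have ns: "mset ns = mset ns'" and ps: "flat ps = flat ps'"
    using P mset_eq_mset_map_iff by metis+
  have "map twos ns @ map three_chain ps \<simeq>\<^bsub>TYPE('a)\<^esub> map twos ns @ map three_chain ps'"
    by (rule three_chains_equiv[OF ps])
  also have "\<dots> \<simeq>\<^bsub>TYPE('a)\<^esub> map twos ns' @ map three_chain ps'"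
    by (rule permute_chains) (simp add: ns)
  finally show ?thesis
    by (rule nonlabeled_ext_class_eqI[OF p q irr cs ds])
qed

lemma same_class_four_block:
  assumes cs: "mset (map twos ns @ [4 # twos m]) = mset (chains (block_sizes ks))"
    and ds: "mset (map twos ns' @ [4 # twos m']) = mset (chains (block_sizes ls))"
  shows "nonlabeled_ext_class p = nonlabeled_ext_class q"
proof -
  let ?o = "\<lambda>n :: nat. 2 * n + 1"
  have four: "list_all2 chain_cycles [4 # twos m] [{#2 * m + 5#}]" for m
    using chain_cycles_four by simp
  have "P_inv p = image_mset ?o (add_mset (m + 2) (mset ns))"
    using reversing_pair.P_inv_mset_chains[OF p cs list_all2_appendI[OF list_all2_twos four]]
    by (simp add: sum_list_twos)
  moreover have "P_inv q = image_mset ?o (add_mset (m' + 2) (mset ns'))"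
    using reversing_pair.P_inv_mset_chains[OF q ds list_all2_appendI[OF list_all2_twos four]]
    by (simp add: sum_list_twos)
  moreover have "inj ?o"
    by (auto intro: injI)
  ultimately have eq: "add_mset (m + 2) (mset ns) = add_mset (m' + 2) (mset ns')"
    using P mset_eq_mset_map_iff by metis
  have "map twos ns @ [4 # twos m] \<simeq>\<^bsub>TYPE('a)\<^esub> map twos ns' @ [4 # twos m']"
  proof (cases "m = m'")
    case True
    then have "mset ns = mset ns'"
      using eq by simp
    then show ?thesis
      by (intro permute_chains) (simp add: True)
  next
    case False
    \<comment> \<open>In each pair the cycle length that the other obtains from its
      \<open>4\<close>-block must come from a chain of \<open>2\<close>-blocks.\<close>
    then obtain N where N: "mset ns = add_mset (m' + 2) N" "mset ns' = add_mset (m + 2) N"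
      using eq by (auto simp: add_eq_conv_ex)
    obtain es where es: "mset es = N"
      using ex_mset by blast
    have "map twos ns @ [4 # twos m] \<simeq>\<^bsub>TYPE('a)\<^esub> map twos es @ [4 # twos m, twos (Suc (Suc m'))]"
      by (rule permute_chains) (simp add: N es)
    also have "\<dots> \<simeq>\<^bsub>TYPE('a)\<^esub> map twos es @ [4 # twos m', twos (Suc (Suc m))]"
      by (rule four_chains_equiv)
    also have "\<dots> \<simeq>\<^bsub>TYPE('a)\<^esub> map twos ns' @ [4 # twos m']"
      by (rule permute_chains) (simp add: N es)
    finally show ?thesis .
  qed
  then show ?thesis
    by (rule nonlabeled_ext_class_eqI[OF p q irr cs ds])
qed

text \<open>The \<open>5\<close>-block contributes the lengths 3 and 3 to both pairs; after
  cancelling them the numbers of \<open>2\<close>-blocks per chain can be compared.\<close>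

lemma same_class_five_block:
  assumes cs: "mset (map twos ns @ [[5]]) = mset (chains (block_sizes ks))"
    and ds: "mset (map twos ns' @ [[5]]) = mset (chains (block_sizes ls))"
  shows "nonlabeled_ext_class p = nonlabeled_ext_class q"
proof -
  let ?o = "\<lambda>n :: nat. 2 * n + 1"
  have five: "list_all2 chain_cycles [[5]] [single_cycles 5]"
    using chain_cycles_single[of 5] by simp
  have "P_inv p = image_mset ?o (mset ns) + single_cycles 5"
    using reversing_pair.P_inv_mset_chains[OF p cs list_all2_appendI[OF list_all2_twos five]]
    by (simp add: sum_list_twos)
  moreover have "P_inv q = image_mset ?o (mset ns') + single_cycles 5"
    using reversing_pair.P_inv_mset_chains[OF q ds list_all2_appendI[OF list_all2_twos five]]
    by (simp add: sum_list_twos)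
  moreover have "inj ?o"
    by (auto intro: injI)
  ultimately have "mset ns = mset ns'"
    using P mset_eq_mset_map_iff by (metis add_right_cancel)
  then have "map twos ns @ [[5]] \<simeq>\<^bsub>TYPE('a)\<^esub> map twos ns' @ [[5]]"
    by (intro permute_chains) simp
  then show ?thesis
    by (rule nonlabeled_ext_class_eqI[OF p q irr cs ds])
qed

text \<open>The number of fixed points of \<^const>\<open>Y_map\<close> is the number of empty chains, which together with the
  size of the alphabet determines the block.\<close>

lemma same_class_single_block:
  assumes cs: "mset (replicate n [] @ map (\<lambda>k. [k]) as) = mset (chains (block_sizes ks))"
    and ds: "mset (replicate n' [] @ map (\<lambda>k. [k]) bs) = mset (chains (block_sizes ls))"
    and len: "length as \<le> 1" "length bs \<le> 1"
    and ge_2: "\<forall>k\<in>set as. 2 \<le> k" "\<forall>k\<in>set bs. 2 \<le> k"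
  shows "nonlabeled_ext_class p = nonlabeled_ext_class q"
proof -
  have P_eq: "P_inv r = replicate_mset n 1 + sum_list (map single_cycles as)"
    "sum_list as + n + length as = CARD('a) - 1"
    if r: "reversing_pair r js" and cs: "mset (replicate n [] @ map (\<lambda>k. [k]) as) = mset (chains (block_sizes js))"
      and "length as \<le> 1" "\<forall>k\<in>set as. 2 \<le> k" for r :: "'a ipair" and js n as
  proof -
    have "list_all2 chain_cycles (replicate n []) (replicate n {#1#})"
      using chain_cycles_twos[of 0] by (auto simp: list_all2_conv_all_nth)
    moreover have "list_all2 chain_cycles (map (\<lambda>k. [k]) as) (map single_cycles as)"
      unfolding list_all2_map1 list_all2_map2
    proof (rule list.rel_refl_strong)
      fix k assume "k \<in> set as"
      then show "chain_cycles [k] (single_cycles k)"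
        using that(4) by (intro chain_cycles_single) auto
    qed
    ultimately have "P_inv r = sum_list (replicate n {#1#} @ map single_cycles as)"
      by (intro reversing_pair.P_inv_mset_chains[OF r cs] list_all2_appendI)
    moreover have "sum_list (replicate n {#1 :: nat#}) = replicate_mset n 1"
      by (induction n) auto
    ultimately show "P_inv r = replicate_mset n 1 + sum_list (map single_cycles as)"
      by simp
    have "sum_list (map sum_list (chains (block_sizes js))) = sum_list as"
      "length (chains (block_sizes js)) = n + length as"
    proof -
      have "mset (map sum_list (chains (block_sizes js))) = mset (map sum_list (replicate n [] @ map (\<lambda>k. [k]) as))"
        unfolding mset_map cs ..
      then have "sum_list (map sum_list (chains (block_sizes js))) =
          sum_list (map sum_list (replicate n [] @ map (\<lambda>k. [k]) as))"
        by (metis sum_mset_sum_list)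
      also have "\<dots> = sum_list as"
        by (simp add: comp_def sum_list_replicate)
      finally show "sum_list (map sum_list (chains (block_sizes js))) = sum_list as" .
      show "length (chains (block_sizes js)) = n + length as"
        using arg_cong[OF cs, of size] by simp
    qed
    then show "sum_list as + n + length as = CARD('a) - 1"
      using sum_list_join_chains[OF chains_nonempty, of "block_sizes js"]
        reversing_pair.sum_sizes[OF r] by simp
  qed
  \<comment> \<open>Blocks of size at least 2 have no fixed points: k+1 is at least 3 for even k,
    and (k+1)/2 is at least 2 for odd k, as then k is at least 3.\<close>
  have no_1: "count (sum_list (map single_cycles as)) 1 = 0" if "\<forall>k\<in>set as. 2 \<le> k" for as
    using that by (induction as) (auto simp: single_cycles_def elim!: oddE)
  have "count (P_inv p) 1 = n" "count (P_inv q) 1 = n'"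
    using P_eq(1)[OF p cs len(1) ge_2(1)] P_eq(1)[OF q ds len(2) ge_2(2)] no_1 ge_2 by simp_all
  then have n: "n = n'"
    using P by simp
  then have "sum_list as + length as = sum_list bs + length bs"
    using P_eq(2)[OF p cs len(1) ge_2(1)] P_eq(2)[OF q ds len(2) ge_2(2)] by simp
  \<comment> \<open>A block of size k contributes k+1, which is at least 3, to this sum, and no
    block contributes 0; so the sum decides between these cases and determines k.\<close>
  then have "as = bs"
    using len ge_2 by (cases as; cases bs) auto
  then show ?thesis
    using nonlabeled_ext_class_eqI[OF p q irr cs ds] n by simp
qed

end

lemma type_1_normal_form:
  assumes "type_cond 1 cs" "\<forall>c\<in>set cs. \<forall>k\<in>set c. 2 \<le> k"
  shows "\<exists>n as. mset (replicate n [] @ map (\<lambda>k. [k]) as) = mset cs \<and> length as \<le> 1 \<and> (\<forall>k\<in>set as. 2 \<le> k)"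
proof -
  let ?ds = "filter (\<lambda>c. c \<noteq> []) cs"
  have ds: "length ?ds \<le> 1" "\<forall>c\<in>set ?ds. length c = 1"
    using assms(1) by (auto simp: type_cond_def)
  have "mset cs = mset (filter (\<lambda>c. c = []) cs) + mset ?ds"
    by (metis (mono_tags, lifting) mset_filter multiset_partition filter_mset_cong)
  moreover have "filter (\<lambda>c. c = []) cs = replicate (length (filter (\<lambda>c. c = []) cs)) []"
    by (rule replicate_length_same[symmetric]) auto
  moreover have "map (\<lambda>k. [k]) (map hd ?ds) = ?ds"
    using ds(2) by (auto simp: length_Suc_conv intro!: map_idI)
  moreover have "\<forall>k\<in>set (map hd ?ds). 2 \<le> k"
    using assms(2) by auto
  ultimately show ?thesis
    using ds(1) by (metis length_map mset_append)
qed

theorem theorem4p6: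
  fixes p q :: "('a::finite) ipair"
  assumes "CARD('a) \<ge> 2"
    and "is_pair p" and "is_pair q"
    and "irreducible_pair p" and "irreducible_pair q"
    and "piecewise_order_reversing p" and "piecewise_order_reversing q"
    and "\<exists>t\<in>{1..5}. has_type t p \<and> has_type t q"
    and "P_inv p = P_inv q"
  shows "nonlabeled_ext_class p = nonlabeled_ext_class q"
proof -
  obtain t ks ls where t: "t \<in> {1..5}"
    and ks: "pwor_decomp p ks" "type_cond t (chains (block_sizes ks))"
    and ls: "pwor_decomp q ls" "type_cond t (chains (block_sizes ls))"
    using assms(8) by (auto simp: has_type_def)
  have p: "reversing_pair p ks" and q: "reversing_pair q ls"
    using assms(1-3) ks(1) ls(1) by (simp_all add: reversing_pair_def)
  note pq = p q assms(4,9)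
  have "t = 1 \<or> t = 2 \<or> t = 3 \<or> t = 4 \<or> t = 5"
    using t by auto
  then consider "t = 1" | "t = 2 \<or> t = 3" | "t = 4" | "t = 5"
    by blast
  then show ?thesis
  proof cases
    case 1
    have ge_2: "\<forall>c\<in>set (chains (block_sizes js)). \<forall>k\<in>set c. 2 \<le> k"
      if "reversing_pair r js" for r :: "'a ipair" and js
      \<comment> \<open>Block sizes are positive and \<open>1\<close>-blocks belong to no chain, so
        what is left is at least 2.\<close>
      using chains_elem reversing_pair.block_sizes_gt_0[OF that] by (metis One_nat_def Suc_leI le_antisym not_less_eq_eq numeral_2_eq_2)
    show ?thesis
      using type_1_normal_form[OF ks(2)[unfolded 1] ge_2[OF p]] type_1_normal_form[OF ls(2)[unfolded 1] ge_2[OF q]]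
        same_class_single_block[OF pq] by blast
  next
    case 2
    have nf: "\<exists>ns ps. mset (map twos ns @ map three_chain ps) = mset cs" if "type_cond t cs" for cs
    proof (rule ex_three_chains, rule ballI)
      fix c assume c: "c \<in> set cs"
      from 2 show "(\<exists>n. c = twos n) \<or> (\<exists>x. c = three_chain x)"
      proof
        assume "t = 2"
        then have "\<forall>x\<in>set c. x = 2"
          using that c by (auto simp: type_cond_def)
        then have "c = twos (length c)"
          by (simp add: replicate_length_same)
        then show ?thesis by blast
      next
        assume "t = 3"
        then have "c \<noteq> [] \<longrightarrow> (\<exists>m l. c = replicate m 2 @ [3] @ replicate l 2) \<or> (\<exists>m\<ge>1. c = replicate m 2)"
          using that c by (auto simp: type_cond_def)
        then show ?thesis
          by (metis replicate_0 three_chain.simps)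
      qed
    qed
    show ?thesis
      using nf[OF ks(2)] nf[OF ls(2)] same_class_twos_three_chains[OF pq] by blast
  next
    case 3
    have nf: "\<exists>ns m. mset (map twos ns @ [4 # twos m]) = mset cs" if tc: "type_cond t cs" for cs
    proof -
      obtain i m where "i < length cs" "cs ! i = 4 # twos m" "\<forall>j<length cs. j \<noteq> i \<longrightarrow> (\<forall>x\<in>set (cs ! j). x = 2)"
        using tc 3 by (auto simp: type_cond_def)
      with ex_remove_nth[of i cs "\<lambda>c. \<forall>x\<in>set c. x = 2"] show ?thesis
        using ex_twos by metis
    qed
    show ?thesis
      using nf[OF ks(2)] nf[OF ls(2)] same_class_four_block[OF pq] by blast
  next
    case 4
    have nf: "\<exists>ns. mset (map twos ns @ [[5]]) = mset cs" if tc: "type_cond t cs" for cs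
    proof -
      obtain i where "i < length cs" "cs ! i = [5]" "\<forall>j<length cs. j \<noteq> i \<longrightarrow> cs ! j = [] \<or> cs ! j = [2]"
        using tc 4 by (auto simp: type_cond_def)
      then obtain ds where ds: "mset (ds @ [[5]]) = mset cs" "\<forall>c\<in>set ds. c = [] \<or> c = [2]"
        using ex_remove_nth[of i cs "\<lambda>c. c = [] \<or> c = [2]"] by metis
      then have "\<forall>c\<in>set ds. \<forall>x\<in>set c. x = 2"
        by auto
      with ds(1) show ?thesis
        using ex_twos by metis
    qed
    show ?thesis
      using nf[OF ks(2)] nf[OF ls(2)] same_class_five_block[OF pq] by blast
  qed
qed

end
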